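(* (1) There exists a unique linear map $\Delta_{\mathrm{rec}}:\mathcal H\to\mathcal H\otimes\mathcal H$ satisfying: (a) $\Delta_{\mathrm{rec}}(\mathbf 1)=\mathbf 1\otimes\mathbf 1$; (b) for every $k\ge1$, $\Delta_{\mathrm{rec}}([\{1\}^k])=\sum_{j=0}^k[\{1\}^j]\otimes[\{1\}^{k-j}]$, where $[\{1\}^j]$ denotes $[1,\dots,1]$ with $j$ entries and $[\{1\}^0]:=\mathbf 1$; (c) for every $k\ge1$, every $(s_1,\dots,s_k)\in\mathbb Z_{\ge1}^k$ and every $1\le i\le k$, $$\Delta_{\mathrm{rec}}([s_1,\dots,s_{i-1},s_i+1,s_{i+1},\dots,s_k])=\frac1{s_i}\big(\mathrm{id}\odot D_i+D_i\otimes\mathrm{id}\big)\Delta_{\mathrm{rec}}([s_1,\dots,s_k]).$$ (2) The quintuple $(\mathcal H,\ш_*,\Delta_{\mathrm{rec}},\mathbf 1,\varepsilon)$ is a connected (with respect to the weight grading) bialgebra, and hence a Hopf algebra.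
   Context: Let $\mathcal H$ be the $\mathbb Q$-vector space with basis consisting of a symbol $\mathbf 1$ together with symbols $[\vec s]=[s_1,\dots,s_k]$ for all $k\ge1$ and $\vec s=(s_1,\dots,s_k)\in\mathbb Z_{\ge1}^k$. Write $\operatorname{dep}(\vec s)=k$ (depth) and $|\vec s|=s_1+\dots+s_k$ (weight), with $\operatorname{dep}(\mathbf 1)=|\mathbf 1|=0$; $\mathcal H$ is graded by weight. On $\mathbb Q\langle x_0,x_1\rangle$ (noncommutative polynomials) let $\ш$ be the shuffle product, defined on words by $1\ш w=w\ш 1=w$ and $au\ш bv=a(u\ш bv)+b(au\ш v)$ for letters $a,b$ and words $u,v$. Let $\rho:\mathcal H\to\mathbb Q\langle x_0,x_1\rangle$ be the injective linear map $\rho(\mathbf 1)=1$, $\rho([s_1,\dots,s_k])=x_0^{s_1-1}x_1x_0^{s_2-1}x_1\cdots x_0^{s_k-1}x_1$; its image (spanned by the empty word and words ending in $x_1$) is closed under $\ш$, and $\ш_*$ denotes the product on $\mathcal H$ given by $u\ш_* v:=\rho^{-1}(\rho(u)\ш\rho(v))$. For $i\ge1$ define linear $\delta_i:\mathcal H\to\mathcal H$ by $\delta_i(\mathbf 1)=0$, $\delta_i[s_1,\dots,s_k]=\sum_{j=1}^i s_j[s_1,\dots,s_j+1,\dots,s_k]$ if $i\le k$ and $=0$ if $i>k$; set $\delta_i=0$ for $i\le0$, and $D_i:=\delta_i-\delta_{i-1}$ for $i\in\mathbb Z$ (so $D_i=0$ for $i\le 0$). For a linear operator $A$ on $\mathcal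 H$ and $i\in\mathbb Z$, the shifted tensor $A\odot D_i:\mathcal H\otimes\mathcal H\to\mathcal H\otimes\mathcal H$ is the linear map $[\vec s]\otimes[\vec t]\mapsto A([\vec s])\otimes D_{i-\operatorname{dep}(\vec s)}([\vec t])$ (basis elements including $\mathbf 1$). The counit $\varepsilon:\mathcal H\to\mathbb Q$ is the linear map with $\varepsilon(\mathbf 1)=1$ and $\varepsilon([\vec s])=0$ for all $\vec s\in\mathbb Z_{\ge1}^k$, $k\ge1$. *)

theory Defs
  imports Complex_Main "HOL-Library.Poly_Mapping"
begin

section \<open>Rational vector spaces with a distinguished basis\<close>

text \<open>
  The \<open>\<rat>\<close>-vector space with basis \<open>'b\<close> is \<open>'b \<Rightarrow>\<^sub>0 rat\<close>. The tensor product of the spaces with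
  bases \<open>'a\<close> and \<open>'b\<close> is the space with basis \<open>'a \<times> 'b\<close>, the pure tensor of two basis
  elements \<open>a\<close> and \<open>b\<close> being the basis element \<open>(a, b)\<close>.
\<close>

definition scl :: "rat \<Rightarrow> ('b \<Rightarrow>\<^sub>0 rat) \<Rightarrow> ('b \<Rightarrow>\<^sub>0 rat)" where
  "scl c u = Poly_Mapping.map ((*) c) u"

lemma lookup_scl [simp]: "Poly_Mapping.lookup (scl c u) b = c * Poly_Mapping.lookup u b"
  by (simp add: scl_def Poly_Mapping.map.rep_eq when_def)

interpretation fvs: vector_space "scl :: rat \<Rightarrow> ('b \<Rightarrow>\<^sub>0 rat) \<Rightarrow> ('b \<Rightarrow>\<^sub>0 rat)"
  by unfold_locales (auto intro!: poly_mapping_eqI simp: lookup_add algebra_simps)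

definition bas :: "'b \<Rightarrow> ('b \<Rightarrow>\<^sub>0 rat)" where
  "bas b = Poly_Mapping.single b 1"

definition lin_ext :: "('a \<Rightarrow> ('b \<Rightarrow>\<^sub>0 rat)) \<Rightarrow> ('a \<Rightarrow>\<^sub>0 rat) \<Rightarrow> ('b \<Rightarrow>\<^sub>0 rat)" where
  "lin_ext f u = (\<Sum>a\<in>Poly_Mapping.keys u. scl (Poly_Mapping.lookup u a) (f a))"

lemma lin_ext_superset:
  assumes "finite A" "Poly_Mapping.keys u \<subseteq> A"
  shows "lin_ext f u = (\<Sum>a\<in>A. scl (Poly_Mapping.lookup u a) (f a))"
  unfolding lin_ext_def
  by (rule sum.mono_neutral_left) (use assms in \<open>auto simp: in_keys_iff\<close>)

lemma linear_lin_ext: "Vector_Spaces.linear scl scl (lin_ext f)"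
proof (unfold_locales)
  fix u v :: "'a \<Rightarrow>\<^sub>0 rat" and c :: rat
  let ?A = "Poly_Mapping.keys u \<union> Poly_Mapping.keys v"
  have "lin_ext f (u + v) = (\<Sum>a\<in>?A. scl (Poly_Mapping.lookup (u + v) a) (f a))"
    by (rule lin_ext_superset) (auto dest: subsetD[OF Poly_Mapping.keys_add])
  also have "\<dots> = lin_ext f u + lin_ext f v"
    by (simp add: lin_ext_superset[of ?A] lookup_add fvs.scale_left_distrib sum.distrib)
  finally show "lin_ext f (u + v) = lin_ext f u + lin_ext f v" .
  have "lin_ext f (scl c u) = (\<Sum>a\<in>Poly_Mapping.keys u. scl (Poly_Mapping.lookup (scl c u) a) (f a))"
    by (rule lin_ext_superset) (auto simp: in_keys_iff)
  then show "lin_ext f (scl c u) = scl c (lin_ext f u)"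
    by (simp add: lin_ext_def fvs.scale_sum_right)
qed

lemma lin_ext_bas [simp]: "lin_ext f (bas a) = f a"
  by (simp add: lin_ext_def bas_def)

definition bilin_ext ::
    "('a \<Rightarrow> 'b \<Rightarrow> ('c \<Rightarrow>\<^sub>0 rat)) \<Rightarrow> ('a \<Rightarrow>\<^sub>0 rat) \<Rightarrow> ('b \<Rightarrow>\<^sub>0 rat) \<Rightarrow> ('c \<Rightarrow>\<^sub>0 rat)" where
  "bilin_ext f u v = lin_ext (\<lambda>a. lin_ext (f a) v) u"

definition tensor :: "('a \<Rightarrow>\<^sub>0 rat) \<Rightarrow> ('b \<Rightarrow>\<^sub>0 rat) \<Rightarrow> ('a \<times> 'b \<Rightarrow>\<^sub>0 rat)"
    (infixr "\<otimes>\<^sub>\<rat>" 75) where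
  "u \<otimes>\<^sub>\<rat> v = bilin_ext (\<lambda>a b. bas (a, b)) u v"

definition tensor_map ::
    "(('a \<Rightarrow>\<^sub>0 rat) \<Rightarrow> ('c \<Rightarrow>\<^sub>0 rat)) \<Rightarrow> (('b \<Rightarrow>\<^sub>0 rat) \<Rightarrow> ('d \<Rightarrow>\<^sub>0 rat))
      \<Rightarrow> ('a \<times> 'b \<Rightarrow>\<^sub>0 rat) \<Rightarrow> ('c \<times> 'd \<Rightarrow>\<^sub>0 rat)" where
  "tensor_map f g = lin_ext (\<lambda>(a, b). f (bas a) \<otimes>\<^sub>\<rat> g (bas b))"

definition tensor_assoc :: "(('a \<times> 'b) \<times> 'c \<Rightarrow>\<^sub>0 rat) \<Rightarrow> ('a \<times> ('b \<times> 'c) \<Rightarrow>\<^sub>0 rat)" where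
  "tensor_assoc = lin_ext (\<lambda>((a, b), c). bas (a, (b, c)))"


section \<open>Bialgebras and Hopf algebras\<close>

definition unital_algebra ::
    "(('b \<Rightarrow>\<^sub>0 rat) \<Rightarrow> ('b \<Rightarrow>\<^sub>0 rat) \<Rightarrow> ('b \<Rightarrow>\<^sub>0 rat)) \<Rightarrow> ('b \<Rightarrow>\<^sub>0 rat) \<Rightarrow> bool" where
  "unital_algebra m e \<longleftrightarrow>
     (\<forall>u. Vector_Spaces.linear scl scl (\<lambda>v. m u v)) \<and>
     (\<forall>v. Vector_Spaces.linear scl scl (\<lambda>u. m u v)) \<and>
     (\<forall>u v w. m (m u v) w = m u (m v w)) \<and>
     (\<forall>u. m e u = u \<and> m u e = u)"

text \<open>The last two conjuncts are \<open>(\<epsilon> \<otimes> id) \<circ> \<Delta> = id\<close> and \<open>(id \<otimes> \<epsilon>) \<circ> \<Delta> = id\<close>,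
  with \<open>\<rat> \<otimes> V\<close> and \<open>V \<otimes> \<rat>\<close> identified with \<open>V\<close>.\<close>

definition coalgebra ::
    "(('b \<Rightarrow>\<^sub>0 rat) \<Rightarrow> ('b \<times> 'b \<Rightarrow>\<^sub>0 rat)) \<Rightarrow> (('b \<Rightarrow>\<^sub>0 rat) \<Rightarrow> rat) \<Rightarrow> bool" where
  "coalgebra \<Delta> \<epsilon> \<longleftrightarrow>
     Vector_Spaces.linear scl scl \<Delta> \<and>
     Vector_Spaces.linear scl (*) \<epsilon> \<and>
     (\<forall>u. tensor_assoc (tensor_map \<Delta> id (\<Delta> u)) = tensor_map id \<Delta> (\<Delta> u)) \<and>
     (\<forall>u. lin_ext (\<lambda>(a, b). scl (\<epsilon> (bas a)) (bas b)) (\<Delta> u) = u) \<and>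
     (\<forall>u. lin_ext (\<lambda>(a, b). scl (\<epsilon> (bas b)) (bas a)) (\<Delta> u) = u)"

definition tensor_mult ::
    "(('b \<Rightarrow>\<^sub>0 rat) \<Rightarrow> ('b \<Rightarrow>\<^sub>0 rat) \<Rightarrow> ('b \<Rightarrow>\<^sub>0 rat))
      \<Rightarrow> ('b \<times> 'b \<Rightarrow>\<^sub>0 rat) \<Rightarrow> ('b \<times> 'b \<Rightarrow>\<^sub>0 rat) \<Rightarrow> ('b \<times> 'b \<Rightarrow>\<^sub>0 rat)" where
  "tensor_mult m =
     bilin_ext (\<lambda>(a, b) (c, d). m (bas a) (bas c) \<otimes>\<^sub>\<rat> m (bas b) (bas d))"

definition bialgebra ::
    "(('b \<Rightarrow>\<^sub>0 rat) \<Rightarrow> ('b \<Rightarrow>\<^sub>0 rat) \<Rightarrow> ('b \<Rightarrow>\<^sub>0 rat)) \<Rightarrow> (('b \<Rightarrow>\<^sub>0 rat) \<Rightarrow> ('b \<times> 'b \<Rightarrow>\<^sub>0 rat))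
      \<Rightarrow> ('b \<Rightarrow>\<^sub>0 rat) \<Rightarrow> (('b \<Rightarrow>\<^sub>0 rat) \<Rightarrow> rat) \<Rightarrow> bool" where
  "bialgebra m \<Delta> e \<epsilon> \<longleftrightarrow>
     unital_algebra m e \<and> coalgebra \<Delta> \<epsilon> \<and>
     (\<forall>u v. \<Delta> (m u v) = tensor_mult m (\<Delta> u) (\<Delta> v)) \<and> \<Delta> e = e \<otimes>\<^sub>\<rat> e \<and>
     (\<forall>u v. \<epsilon> (m u v) = \<epsilon> u * \<epsilon> v) \<and> \<epsilon> e = 1"

definition grading :: "(nat \<Rightarrow> ('b \<Rightarrow>\<^sub>0 rat) set) \<Rightarrow> bool" where
  "grading G \<longleftrightarrow>
     (\<forall>n. fvs.subspace (G n)) \<and>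
     (\<forall>u. \<exists>!f :: nat \<Rightarrow>\<^sub>0 ('b \<Rightarrow>\<^sub>0 rat).
        (\<forall>n. Poly_Mapping.lookup f n \<in> G n) \<and>
        u = (\<Sum>n\<in>Poly_Mapping.keys f. Poly_Mapping.lookup f n))"

text \<open>All structure maps are homogeneous of degree \<open>0\<close>, the field being in degree \<open>0\<close>.\<close>

definition graded_bialgebra ::
    "(nat \<Rightarrow> ('b \<Rightarrow>\<^sub>0 rat) set)
      \<Rightarrow> (('b \<Rightarrow>\<^sub>0 rat) \<Rightarrow> ('b \<Rightarrow>\<^sub>0 rat) \<Rightarrow> ('b \<Rightarrow>\<^sub>0 rat)) \<Rightarrow> (('b \<Rightarrow>\<^sub>0 rat) \<Rightarrow> ('b \<times> 'b \<Rightarrow>\<^sub>0 rat))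
      \<Rightarrow> ('b \<Rightarrow>\<^sub>0 rat) \<Rightarrow> (('b \<Rightarrow>\<^sub>0 rat) \<Rightarrow> rat) \<Rightarrow> bool" where
  "graded_bialgebra G m \<Delta> e \<epsilon> \<longleftrightarrow>
     bialgebra m \<Delta> e \<epsilon> \<and> grading G \<and>
     (\<forall>p q. \<forall>u\<in>G p. \<forall>v\<in>G q. m u v \<in> G (p + q)) \<and>
     (\<forall>n. \<forall>u\<in>G n. \<Delta> u \<in> fvs.span {v \<otimes>\<^sub>\<rat> w | v w p q. v \<in> G p \<and> w \<in> G q \<and> p + q = n}) \<and>
     e \<in> G 0 \<and>
     (\<forall>n>0. \<forall>u\<in>G n. \<epsilon> u = 0)"

definition connected_bialgebra ::
    "(nat \<Rightarrow> ('b \<Rightarrow>\<^sub>0 rat) set)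
      \<Rightarrow> (('b \<Rightarrow>\<^sub>0 rat) \<Rightarrow> ('b \<Rightarrow>\<^sub>0 rat) \<Rightarrow> ('b \<Rightarrow>\<^sub>0 rat)) \<Rightarrow> (('b \<Rightarrow>\<^sub>0 rat) \<Rightarrow> ('b \<times> 'b \<Rightarrow>\<^sub>0 rat))
      \<Rightarrow> ('b \<Rightarrow>\<^sub>0 rat) \<Rightarrow> (('b \<Rightarrow>\<^sub>0 rat) \<Rightarrow> rat) \<Rightarrow> bool" where
  "connected_bialgebra G m \<Delta> e \<epsilon> \<longleftrightarrow>
     graded_bialgebra G m \<Delta> e \<epsilon> \<and> G 0 = fvs.span {e}"

definition mult_map ::
    "(('b \<Rightarrow>\<^sub>0 rat) \<Rightarrow> ('b \<Rightarrow>\<^sub>0 rat) \<Rightarrow> ('b \<Rightarrow>\<^sub>0 rat)) \<Rightarrow> ('b \<times> 'b \<Rightarrow>\<^sub>0 rat) \<Rightarrow> ('b \<Rightarrow>\<^sub>0 rat)" where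
  "mult_map m = lin_ext (\<lambda>(a, b). m (bas a) (bas b))"

definition antipode ::
    "(('b \<Rightarrow>\<^sub>0 rat) \<Rightarrow> ('b \<Rightarrow>\<^sub>0 rat) \<Rightarrow> ('b \<Rightarrow>\<^sub>0 rat)) \<Rightarrow> (('b \<Rightarrow>\<^sub>0 rat) \<Rightarrow> ('b \<times> 'b \<Rightarrow>\<^sub>0 rat))
      \<Rightarrow> ('b \<Rightarrow>\<^sub>0 rat) \<Rightarrow> (('b \<Rightarrow>\<^sub>0 rat) \<Rightarrow> rat) \<Rightarrow> (('b \<Rightarrow>\<^sub>0 rat) \<Rightarrow> ('b \<Rightarrow>\<^sub>0 rat)) \<Rightarrow> bool" where
  "antipode m \<Delta> e \<epsilon> S \<longleftrightarrow>
     Vector_Spaces.linear scl scl S \<and>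
     (\<forall>u. mult_map m (tensor_map S id (\<Delta> u)) = scl (\<epsilon> u) e) \<and>
     (\<forall>u. mult_map m (tensor_map id S (\<Delta> u)) = scl (\<epsilon> u) e)"

definition hopf_algebra ::
    "(('b \<Rightarrow>\<^sub>0 rat) \<Rightarrow> ('b \<Rightarrow>\<^sub>0 rat) \<Rightarrow> ('b \<Rightarrow>\<^sub>0 rat)) \<Rightarrow> (('b \<Rightarrow>\<^sub>0 rat) \<Rightarrow> ('b \<times> 'b \<Rightarrow>\<^sub>0 rat))
      \<Rightarrow> ('b \<Rightarrow>\<^sub>0 rat) \<Rightarrow> (('b \<Rightarrow>\<^sub>0 rat) \<Rightarrow> rat) \<Rightarrow> bool" where
  "hopf_algebra m \<Delta> e \<epsilon> \<longleftrightarrow> bialgebra m \<Delta> e \<epsilon> \<and> (\<exists>S. antipode m \<Delta> e \<epsilon> S)"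


section \<open>The space \<open>\<H>\<close> and its shuffle product\<close>

text \<open>
  The type \<^typ>\<open>num\<close> is the type of positive integers (\<open>nat_of_num\<close> is a bijection from it onto
  the positive natural numbers), so \<^typ>\<open>num list\<close> is the set of all tuples \<open>(s\<^sub>1, \<dots>, s\<^sub>k)\<close> of
  positive integers with \<open>k \<ge> 0\<close>. The empty list stands for the symbol \<open>\<one>\<close>.
  Lists are indexed from \<open>0\<close>: \<open>s\<^sub>j\<close> is \<open>s ! (j - 1)\<close>.
\<close>

type_synonym H = "num list \<Rightarrow>\<^sub>0 rat"
type_synonym HH = "num list \<times> num list \<Rightarrow>\<^sub>0 rat"

definition H_one :: H where
  "H_one = bas []"

abbreviation dep :: "num list \<Rightarrow> nat" where
  "dep s \<equiv> length s"

definition weight :: "num list \<Rightarrow> nat" where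
  "weight s = sum_list (map nat_of_num s)"

definition H_weight :: "nat \<Rightarrow> H set" where
  "H_weight n = fvs.span {bas s | s. weight s = n}"

definition H_counit :: "H \<Rightarrow> rat" where
  "H_counit u = Poly_Mapping.lookup u []"

datatype letter = X0 | X1

definition prepend :: "'a \<Rightarrow> ('a list \<Rightarrow>\<^sub>0 rat) \<Rightarrow> ('a list \<Rightarrow>\<^sub>0 rat)" where
  "prepend a = lin_ext (\<lambda>w. bas (a # w))"

fun shuffle_words :: "'a list \<Rightarrow> 'a list \<Rightarrow> ('a list \<Rightarrow>\<^sub>0 rat)" where
  "shuffle_words [] w = bas w"
| "shuffle_words w [] = bas w"
| "shuffle_words (a # u) (b # v) =
     prepend a (shuffle_words u (b # v)) + prepend b (shuffle_words (a # u) v)"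

definition shuffle :: "('a list \<Rightarrow>\<^sub>0 rat) \<Rightarrow> ('a list \<Rightarrow>\<^sub>0 rat) \<Rightarrow> ('a list \<Rightarrow>\<^sub>0 rat)" where
  "shuffle = bilin_ext shuffle_words"

definition rho_word :: "num list \<Rightarrow> letter list" where
  "rho_word s = concat (map (\<lambda>n. replicate (nat_of_num n - 1) X0 @ [X1]) s)"

definition rho :: "H \<Rightarrow> (letter list \<Rightarrow>\<^sub>0 rat)" where
  "rho = lin_ext (\<lambda>s. bas (rho_word s))"

lemma rho_word_Nil [simp]: "rho_word [] = []"
  by (simp add: rho_word_def)

lemma rho_word_Cons [simp]:
  "rho_word (n # s) = replicate (nat_of_num n - 1) X0 @ X1 # rho_word s"
  by (simp add: rho_word_def)

lemma replicate_X0_eq_iff: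
  "replicate m X0 @ X1 # u = replicate n X0 @ X1 # v \<longleftrightarrow> m = n \<and> u = v"
proof (induction m arbitrary: n)
  case 0 then show ?case by (cases n) auto
next
  case (Suc m) then show ?case by (cases n) auto
qed

lemma inj_rho_word: "inj rho_word"
proof (rule injI)
  fix s t show "rho_word s = rho_word t \<Longrightarrow> s = t"
  proof (induction s arbitrary: t)
    case Nil then show ?case by (cases t) auto
  next
    case (Cons n s)
    then obtain m t' where t: "t = m # t'" by (cases t) auto
    have "nat_of_num n - 1 = nat_of_num m - 1" "rho_word s = rho_word t'"
      using Cons.prems by (auto simp: t replicate_X0_eq_iff)
    moreover have "nat_of_num n > 0" "nat_of_num m > 0" by (auto simp: nat_of_num_pos)
    ultimately have "nat_of_num n = nat_of_num m" "s = t'"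
      using Cons.IH by auto
    then show ?case by (simp add: t num_eq_iff)
  qed
qed

lemma lookup_rho: "Poly_Mapping.lookup (rho u) (rho_word s) = Poly_Mapping.lookup u s"
proof -
  have "Poly_Mapping.lookup (rho u) (rho_word s) =
      (\<Sum>a\<in>Poly_Mapping.keys u. if a = s then Poly_Mapping.lookup u a else 0)"
    unfolding rho_def lin_ext_def lookup_sum
    by (rule sum.cong) (auto simp: bas_def lookup_single when_def inj_eq[OF inj_rho_word])
  also have "\<dots> = Poly_Mapping.lookup u s"
    by (simp add: in_keys_iff)
  finally show ?thesis .
qed

lemma inj_rho: "inj rho"
  by (rule injI, rule poly_mapping_eqI) (metis lookup_rho)

lemma rho_word_surj: "w = [] \<or> last w = X1 \<Longrightarrow> w \<in> range rho_word"
proof (induction w)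
  case Nil then show ?case by (metis rangeI rho_word_Nil)
next
  case (Cons a w)
  show ?case
  proof (cases a)
    case X1
    have "w \<in> range rho_word" using Cons by (auto split: if_splits)
    then obtain s where "w = rho_word s" by auto
    then have "a # w = rho_word (num.One # s)" using X1 by simp
    then show ?thesis by blast
  next
    case X0
    then have "w \<noteq> []" "w \<in> range rho_word" using Cons by (auto split: if_splits)
    then obtain t where t: "w = rho_word t" by auto
    with \<open>w \<noteq> []\<close> obtain n s where "w = rho_word (n # s)" by (cases t) auto
    then have "a # w = rho_word (Num.inc n # s)"
      using X0 nat_of_num_pos[of n] by (cases "nat_of_num n") (auto simp: nat_of_num_inc)
    then show ?thesis by blast
  qed
qed

lemma range_rho: "range rho = fvs.span {bas w | w. w = [] \<or> last w = X1}"
proof -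
  interpret rho: Vector_Spaces.linear scl scl rho
    unfolding rho_def by (rule linear_lin_ext)
  have last: "rho_word s = [] \<or> last (rho_word s) = X1" for s
    by (induction s) auto
  have "rho u \<in> fvs.span {bas w | w. w = [] \<or> last w = X1}" for u
  proof -
    have "bas (rho_word s) \<in> {bas w | w. w = [] \<or> last w = X1}" for s
      using last[of s] by blast
    then show ?thesis
      unfolding rho_def lin_ext_def by (intro fvs.span_sum fvs.span_scale fvs.span_base)
  qed
  moreover have "bas w \<in> range rho" if w: "w = [] \<or> last w = X1" for w
  proof -
    obtain s where "w = rho_word s" using rho_word_surj[OF w] by blast
    then have "bas w = rho (bas s)" by (simp add: rho_def)
    then show ?thesis by blast
  qed
  then have "fvs.span {bas w | w. w = [] \<or> last w = X1} \<subseteq> range rho"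
    by (intro fvs.span_minimal rho.subspace_image) auto
  ultimately show ?thesis by blast
qed

lemma prepend_range_rho:
  assumes "u \<in> fvs.span {bas w | w. w \<noteq> [] \<and> last w = X1}"
  shows "prepend a u \<in> fvs.span {bas w | w. w \<noteq> [] \<and> last w = X1}"
proof -
  let ?S = "fvs.span {bas w | w. w \<noteq> [] \<and> last w = X1}"
  interpret p: Vector_Spaces.linear scl scl "prepend a"
    unfolding prepend_def by (rule linear_lin_ext)
  have "prepend a ` ?S \<subseteq> ?S"
    unfolding p.span_image[symmetric]
  proof (rule fvs.span_mono, rule subsetI)
    fix x assume "x \<in> prepend a ` {bas w | w. w \<noteq> [] \<and> last w = X1}"
    then obtain w where "w \<noteq> []" "last w = X1" "x = bas (a # w)"
      by (auto simp: prepend_def)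
    then show "x \<in> {bas w | w. w \<noteq> [] \<and> last w = X1}"
      by (intro CollectI exI[of _ "a # w"]) simp
  qed
  then show ?thesis using assms by blast
qed

lemma shuffle_words_span:
  "u = [] \<or> last u = X1 \<Longrightarrow> v = [] \<or> last v = X1 \<Longrightarrow> u \<noteq> [] \<or> v \<noteq> [] \<Longrightarrow>
    shuffle_words u v \<in> fvs.span {bas w | w. w \<noteq> [] \<and> last w = X1}"
proof (induction u v rule: shuffle_words.induct)
  case (3 a u b v)
  let ?S = "fvs.span {bas w | w. w \<noteq> [] \<and> last w = X1}"
  have "shuffle_words u (b # v) \<in> ?S" "shuffle_words (a # u) v \<in> ?S"
    using 3 by (auto split: if_splits)
  then show ?case by (auto intro!: fvs.span_add prepend_range_rho)
qed (auto intro!: fvs.span_base)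

lemma shuffle_range_rho: "shuffle (rho u) (rho v) \<in> range rho"
proof -
  let ?T = "fvs.span {bas w | w :: letter list. w = [] \<or> last w = X1}"
  have last: "Poly_Mapping.keys (rho x) \<subseteq> {w. w = [] \<or> last w = X1}" for x
  proof -
    have last': "rho_word s = [] \<or> last (rho_word s) = X1" for s
      by (induction s) auto
    have "Poly_Mapping.lookup (rho x) w = 0" if "\<not> (w = [] \<or> last w = X1)" for w
      unfolding rho_def lin_ext_def lookup_sum
      by (rule sum.neutral) (use last' that in \<open>auto simp: bas_def lookup_single when_def\<close>)
    then show ?thesis by (auto simp: in_keys_iff)
  qed
  have "shuffle_words a b \<in> ?T" if "a = [] \<or> last a = X1" "b = [] \<or> last b = X1" for a b
  proof (cases "a = [] \<and> b = []")
    case True then show ?thesis by (auto intro!: fvs.span_base)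
  next
    case False
    then have "shuffle_words a b \<in> fvs.span {bas w | w. w \<noteq> [] \<and> last w = X1}"
      using shuffle_words_span that by blast
    moreover have "fvs.span {bas w | w. w \<noteq> [] \<and> last w = X1} \<subseteq> ?T"
      by (rule fvs.span_mono) auto
    ultimately show ?thesis by blast
  qed
  then show ?thesis
    unfolding range_rho shuffle_def bilin_ext_def lin_ext_def[of _ "rho _"]
    using subsetD[OF last] by (intro fvs.span_sum fvs.span_scale) simp
qed

definition H_shuffle :: "H \<Rightarrow> H \<Rightarrow> H" where
  "H_shuffle u v = inv rho (shuffle (rho u) (rho v))"


section \<open>The recursive coproduct\<close>

definition incr :: "nat \<Rightarrow> num list \<Rightarrow> num list" where
  "incr j s = s[j - 1 := s ! (j - 1) + num.One]"

definition delta :: "int \<Rightarrow> H \<Rightarrow> H" where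
  "delta i = lin_ext (\<lambda>s. if 1 \<le> i \<and> i \<le> int (dep s)
     then \<Sum>j = 1..nat i. scl (numeral (s ! (j - 1))) (bas (incr j s)) else 0)"

definition D_op :: "int \<Rightarrow> H \<Rightarrow> H" where
  "D_op i u = delta i u - delta (i - 1) u"

definition shifted_tensor :: "(H \<Rightarrow> H) \<Rightarrow> int \<Rightarrow> HH \<Rightarrow> HH" where
  "shifted_tensor A i = lin_ext (\<lambda>(s, t). A (bas s) \<otimes>\<^sub>\<rat> D_op (i - int (dep s)) (bas t))"

definition is_rec_coproduct :: "(H \<Rightarrow> HH) \<Rightarrow> bool" where
  "is_rec_coproduct \<Delta> \<longleftrightarrow>
     Vector_Spaces.linear scl scl \<Delta> \<and>
     \<Delta> H_one = H_one \<otimes>\<^sub>\<rat> H_one \<and>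
     (\<forall>k\<ge>1. \<Delta> (bas (replicate k num.One)) =
        (\<Sum>j = 0..k. bas (replicate j num.One) \<otimes>\<^sub>\<rat> bas (replicate (k - j) num.One))) \<and>
     (\<forall>s i. 1 \<le> i \<and> i \<le> dep s \<longrightarrow>
        \<Delta> (bas (incr i s)) =
          scl (1 / numeral (s ! (i - 1)))
            (shifted_tensor id (int i) (\<Delta> (bas s)) + tensor_map (D_op (int i)) id (\<Delta> (bas s))))"

end

theory Submission
  imports Defs "HOL-Library.List_Lexorder"
begin

text \<open>
  Identify \<open>[s\<^sub>1, \<dots>, s\<^sub>k]\<close> with the divided-power monomial \<open>\<Prod> X\<^sub>i\<^bsup>s\<^sub>i - 1\<^esup>/(s\<^sub>i - 1)!\<close>, so that the depth \<open>k\<close> part of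
  \<open>\<H>\<close> is \<open>\<rat>[X\<^sub>1, \<dots>, X\<^sub>k]\<close>, on which \<open>D\<^sub>i\<close> is multiplication by \<open>X\<^sub>i\<close> and \<open>\<delta>\<^sub>i\<close> multiplication by
  \<open>U\<^sub>i = X\<^sub>1 + \<dots> + X\<^sub>i\<close>. In the coordinates \<open>U\<^sub>i\<close> the recursion for the coproduct says exactly that
  it is deconcatenation, and the shuffle product of words in \<open>x\<^sub>0, x\<^sub>1\<close> becomes the shuffle product of
  words in the letters \<open>U\<^sup>n/n!\<close>. Hence \<open>\<H>\<close> is the shuffle Hopf algebra on these letters, with
  antipode \<open>w \<mapsto> (-1)\<^bsup>|w|\<^esup> rev w\<close>.

  Prepending the letter \<open>U\<^sup>n/n!\<close> is the operator \<open>f \<mapsto> X\<^sub>1\<^sup>n/n! f(X\<^sub>1 + X\<^sub>2, X\<^sub>3, \<dots>)\<close>. It satisfies the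
  shuffle recursion because removing a leading \<open>x\<^sub>0\<close> or a leading \<open>x\<^sub>1\<close> is a derivation of the
  shuffle product, and these two derivations detect elements without constant term.
\<close>

section \<open>Linear maps on free rational vector spaces\<close>

abbreviation lin :: "(('a \<Rightarrow>\<^sub>0 rat) \<Rightarrow> ('b \<Rightarrow>\<^sub>0 rat)) \<Rightarrow> bool" where
  "lin \<equiv> Vector_Spaces.linear scl scl"

lemma lin_iff: "lin f \<longleftrightarrow> (\<forall>u v. f (u + v) = f u + f v) \<and> (\<forall>c u. f (scl c u) = scl c (f u))"
  by (auto simp: Vector_Spaces.linear_iff fvs.vector_space_axioms)

lemma linI: "(\<And>u v. f (u + v) = f u + f v) \<Longrightarrow> (\<And>c u. f (scl c u) = scl c (f u)) \<Longrightarrow> lin f"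
  by (simp add: lin_iff)

lemma lin_add: "lin f \<Longrightarrow> f (u + v) = f u + f v"
  by (simp add: lin_iff)

lemma lin_scl: "lin f \<Longrightarrow> f (scl c u) = scl c (f u)"
  by (simp add: lin_iff)

lemma lin_0: "lin f \<Longrightarrow> f 0 = 0"
  using lin_scl[of f 0 0] by simp

lemma lin_diff: "lin f \<Longrightarrow> f (u - v) = f u - f v"
  using lin_add[of f "u - v" v] by simp

lemma lin_uminus: "lin f \<Longrightarrow> f (- u) = - f u"
  using lin_diff[of f 0 u] lin_0[of f] by simp

lemma lin_sum: "lin f \<Longrightarrow> f (\<Sum>i\<in>I. g i) = (\<Sum>i\<in>I. f (g i))"
  by (induction I rule: infinite_finite_induct) (auto simp: lin_0 lin_add)

lemma lin_ident: "lin (\<lambda>u. u)" and lin_id: "lin id"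
  by (auto simp: lin_iff)

lemma lin_compose: "lin f \<Longrightarrow> lin g \<Longrightarrow> lin (\<lambda>u. f (g u))"
  by (auto simp: lin_iff)

lemma lin_plus: "lin f \<Longrightarrow> lin g \<Longrightarrow> lin (\<lambda>u. f u + g u)"
  by (auto simp: lin_iff fvs.scale_right_distrib)

lemma lin_minus: "lin f \<Longrightarrow> lin g \<Longrightarrow> lin (\<lambda>u. f u - g u)"
  by (auto simp: lin_iff fvs.scale_right_diff_distrib)

lemma lin_scale: "lin f \<Longrightarrow> lin (\<lambda>u. scl c (f u))"
  by (auto simp: lin_iff fvs.scale_right_distrib mult.commute)

lemma lin_zero: "lin (\<lambda>u. 0)"
  by (auto simp: lin_iff)

lemma lin_if: "lin f \<Longrightarrow> lin g \<Longrightarrow> lin (\<lambda>u. if P then f u else g u)"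
  by (cases P) simp_all

lemma lin_functional: "Vector_Spaces.linear scl (*) p \<Longrightarrow> lin (\<lambda>u. scl (p u) v)"
  by (auto simp: lin_iff Vector_Spaces.linear_iff fvs.scale_left_distrib fvs.vector_space_axioms)

lemma span_bas: "fvs.span (range bas) = UNIV"
proof -
  have "u \<in> fvs.span (range bas)" for u :: "'b \<Rightarrow>\<^sub>0 rat"
  proof -
    have "u = (\<Sum>a\<in>Poly_Mapping.keys u. scl (Poly_Mapping.lookup u a) (bas a))"
      by (rule poly_mapping_eqI)
        (simp add: lookup_sum bas_def lookup_single when_def in_keys_iff if_distrib cong: if_cong)
    then show ?thesis
      by (metis (no_types, lifting) fvs.span_base fvs.span_scale fvs.span_sum rangeI)
  qed
  then show ?thesis by auto
qed

lemma lin_eq_span: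
  assumes "lin f" "lin g" "u \<in> fvs.span A" "\<And>a. a \<in> A \<Longrightarrow> f a = g a"
  shows "f u = g u"
  using assms(3)
proof (induction rule: fvs.span_induct_alt)
  case base
  then show ?case using assms(1,2) by (simp add: lin_0)
next
  case (step c x y)
  then show ?case using assms by (simp add: lin_add lin_scl)
qed

lemma lin_eq_bas:
  assumes "lin f" "lin g" "\<And>a. f (bas a) = g (bas a)"
  shows "f u = g u"
  by (rule lin_eq_span[OF assms(1,2), of _ "range bas"]) (auto simp: span_bas assms)

text \<open>Turns homogeneity into a condition on the support: the weight components and the spans
  of words of fixed length below are all of this form.\<close>

lemma mem_span_bas: "u \<in> fvs.span {bas s | s. P s} \<longleftrightarrow> (\<forall>s\<in>Poly_Mapping.keys u. P s)"
proof
  assume "u \<in> fvs.span {bas s | s. P s}"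
  then show "\<forall>s\<in>Poly_Mapping.keys u. P s"
  proof (induction rule: fvs.span_induct_alt)
    case base
    then show ?case by simp
  next
    case (step c x y)
    then obtain s where "x = bas s" "P s" by auto
    then have "t = s \<or> t \<in> Poly_Mapping.keys y" if "t \<in> Poly_Mapping.keys (scl c x + y)" for t
      using that by (auto simp: in_keys_iff lookup_add bas_def lookup_single when_def split: if_splits)
    then show ?case
      using step(2) \<open>P s\<close> by blast
  qed
next
  assume "\<forall>s\<in>Poly_Mapping.keys u. P s"
  then have "lin_ext bas u \<in> fvs.span {bas s | s. P s}"
    unfolding lin_ext_def by (intro fvs.span_sum fvs.span_scale fvs.span_base) auto
  moreover have "lin_ext bas u = u"
    by (rule lin_eq_bas[of "lin_ext bas"]) (auto intro!: linear_lin_ext lin_ident)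
  ultimately show "u \<in> fvs.span {bas s | s. P s}" by simp
qed

lemma lin_mem_span:
  assumes "lin f" "u \<in> fvs.span A" "fvs.subspace V" "\<And>a. a \<in> A \<Longrightarrow> f a \<in> V"
  shows "f u \<in> V"
  using assms(2)
proof (induction rule: fvs.span_induct_alt)
  case base
  then show ?case using assms by (simp add: lin_0 fvs.subspace_0)
next
  case (step c x y)
  then show ?case using assms by (simp add: lin_add lin_scl fvs.subspace_add fvs.subspace_scale)
qed

lemma lin_ext_plus: "lin_ext (\<lambda>a. f a + g a) u = lin_ext f u + lin_ext g u"
  by (simp add: lin_ext_def fvs.scale_right_distrib sum.distrib)

lemma lin_ext_scale: "lin_ext (\<lambda>a. scl c (f a)) u = scl c (lin_ext f u)"
  by (simp add: lin_ext_def fvs.scale_sum_right mult.commute)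

lemma lin_lin_ext: "lin g \<Longrightarrow> lin (\<lambda>u. lin_ext f (g u))"
  by (rule lin_compose[OF linear_lin_ext])

lemma lin_inv_lin_ext:
  assumes "bij (lin_ext e)"
  shows "lin (inv (lin_ext e))"
proof (rule linI)
  fix u v c
  have inv_e: "inv (lin_ext e) (lin_ext e x) = x" for x
    using assms by (simp add: bij_is_inj)
  obtain x y where xy: "u = lin_ext e x" "v = lin_ext e y" using assms by (metis bij_pointE)
  show "inv (lin_ext e) (u + v) = inv (lin_ext e) u + inv (lin_ext e) v"
    unfolding xy by (simp only: inv_e lin_add[OF linear_lin_ext, symmetric])
  show "inv (lin_ext e) (scl c u) = scl c (inv (lin_ext e) u)"
    unfolding xy by (simp only: inv_e lin_scl[OF linear_lin_ext, symmetric])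
qed

section \<open>Bilinear extensions and tensor constructions\<close>

lemma lin_bilin_ext_left: "lin g \<Longrightarrow> lin (\<lambda>u. bilin_ext f (g u) v)"
  unfolding bilin_ext_def by (rule lin_lin_ext)

lemma lin_bilin_ext_right: "lin g \<Longrightarrow> lin (\<lambda>v. bilin_ext f u (g v))"
  unfolding bilin_ext_def
  by (rule linI) (simp_all add: lin_add lin_scl linear_lin_ext lin_ext_plus lin_ext_scale)

lemma bilin_ext_bas [simp]: "bilin_ext f (bas a) (bas b) = f a b"
  by (simp add: bilin_ext_def)

lemma lin_tensor_left: "lin g \<Longrightarrow> lin (\<lambda>u. g u \<otimes>\<^sub>\<rat> v)"
  unfolding tensor_def by (rule lin_bilin_ext_left)

lemma lin_tensor_right: "lin g \<Longrightarrow> lin (\<lambda>v. u \<otimes>\<^sub>\<rat> g v)"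
  unfolding tensor_def by (rule lin_bilin_ext_right)

lemma tensor_bas: "bas a \<otimes>\<^sub>\<rat> bas b = bas (a, b)"
  by (simp add: tensor_def)

lemma lin_tensor_map: "lin h \<Longrightarrow> lin (\<lambda>u. tensor_map f g (h u))"
  unfolding tensor_map_def by (rule lin_lin_ext)

lemma lin_tensor_assoc: "lin h \<Longrightarrow> lin (\<lambda>u. tensor_assoc (h u))"
  unfolding tensor_assoc_def by (rule lin_lin_ext)

lemma lin_tensor_mult_left: "lin h \<Longrightarrow> lin (\<lambda>u. tensor_mult m (h u) v)"
  unfolding tensor_mult_def by (rule lin_bilin_ext_left)

lemma lin_tensor_mult_right: "lin h \<Longrightarrow> lin (\<lambda>v. tensor_mult m u (h v))"
  unfolding tensor_mult_def by (rule lin_bilin_ext_right)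

lemma lin_mult_map: "lin h \<Longrightarrow> lin (\<lambda>u. mult_map m (h u))"
  unfolding mult_map_def by (rule lin_lin_ext)

text \<open>Most of these rules carry an inner linear map, so that \<open>intro\<close> descends
  through nested expressions and closes the linearity goals left by the extensionality
  lemmas.\<close>

lemmas lin_intros = lin_ident lin_id lin_zero lin_if lin_plus lin_minus lin_scale lin_lin_ext
  lin_tensor_left lin_tensor_right lin_tensor_map lin_tensor_assoc
  lin_tensor_mult_left lin_tensor_mult_right lin_mult_map

lemma tensor_add_left: "(u + u') \<otimes>\<^sub>\<rat> v = u \<otimes>\<^sub>\<rat> v + u' \<otimes>\<^sub>\<rat> v"
  by (rule lin_add[OF lin_tensor_left[OF lin_ident]])

lemma tensor_add_right: "u \<otimes>\<^sub>\<rat> (v + v') = u \<otimes>\<^sub>\<rat> v + u \<otimes>\<^sub>\<rat> v'"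
  by (rule lin_add[OF lin_tensor_right[OF lin_ident]])

lemma tensor_map_add: "tensor_map f g (x + y) = tensor_map f g x + tensor_map f g y"
  unfolding tensor_map_def by (rule lin_add[OF linear_lin_ext])

lemma tensor_assoc_add: "tensor_assoc (x + y) = tensor_assoc x + tensor_assoc y"
  unfolding tensor_assoc_def by (rule lin_add[OF linear_lin_ext])

lemma mult_map_add: "mult_map m (x + y) = mult_map m x + mult_map m y"
  unfolding mult_map_def by (rule lin_add[OF linear_lin_ext])

lemma tensor_mult_add_left: "tensor_mult m (x + y) z = tensor_mult m x z + tensor_mult m y z"
  by (rule lin_add[OF lin_tensor_mult_left[OF lin_ident]])

lemma tensor_mult_add_right: "tensor_mult m z (x + y) = tensor_mult m z x + tensor_mult m z y"
  by (rule lin_add[OF lin_tensor_mult_right[OF lin_ident]])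

lemma tensor_map_tensor:
  assumes "lin f" "lin g"
  shows "tensor_map f g (u \<otimes>\<^sub>\<rat> v) = f u \<otimes>\<^sub>\<rat> g v"
proof (rule lin_eq_bas[of "\<lambda>u. tensor_map f g (u \<otimes>\<^sub>\<rat> v)"])
  fix a
  show "tensor_map f g (bas a \<otimes>\<^sub>\<rat> v) = f (bas a) \<otimes>\<^sub>\<rat> g v"
    by (rule lin_eq_bas[of "\<lambda>v. tensor_map f g (bas a \<otimes>\<^sub>\<rat> v)"])
      (auto intro!: lin_intros assms simp: tensor_bas tensor_map_def)
qed (auto intro!: lin_intros assms)

lemma tensor_assoc_tensor: "tensor_assoc ((u \<otimes>\<^sub>\<rat> v) \<otimes>\<^sub>\<rat> w) = u \<otimes>\<^sub>\<rat> (v \<otimes>\<^sub>\<rat> w)"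
proof (rule lin_eq_bas[of "\<lambda>u. tensor_assoc ((u \<otimes>\<^sub>\<rat> v) \<otimes>\<^sub>\<rat> w)"])
  fix a
  show "tensor_assoc ((bas a \<otimes>\<^sub>\<rat> v) \<otimes>\<^sub>\<rat> w) = bas a \<otimes>\<^sub>\<rat> (v \<otimes>\<^sub>\<rat> w)"
  proof (rule lin_eq_bas[of "\<lambda>v. tensor_assoc ((bas a \<otimes>\<^sub>\<rat> v) \<otimes>\<^sub>\<rat> w)"])
    fix b
    show "tensor_assoc ((bas a \<otimes>\<^sub>\<rat> bas b) \<otimes>\<^sub>\<rat> w) = bas a \<otimes>\<^sub>\<rat> (bas b \<otimes>\<^sub>\<rat> w)"
      by (rule lin_eq_bas[of "\<lambda>w. tensor_assoc ((bas a \<otimes>\<^sub>\<rat> bas b) \<otimes>\<^sub>\<rat> w)"])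
        (auto intro!: lin_intros simp: tensor_bas tensor_assoc_def)
  qed (auto intro!: lin_intros)
qed (auto intro!: lin_intros)

text \<open>Basis elements of the tensor product are pure tensors, so the basis criterion suffices.
  Identities below are thereby reduced to pure tensors, with no sums to handle.\<close>

lemma lin_eq_tensor:
  assumes "lin f" "lin g" "\<And>u v. f (u \<otimes>\<^sub>\<rat> v) = g (u \<otimes>\<^sub>\<rat> v)"
  shows "f x = g x"
  by (rule lin_eq_bas[OF assms(1,2)]) (metis assms(3) surj_pair tensor_bas)

lemma lin_ext_eval_left:
  assumes "Vector_Spaces.linear scl (*) p"
  shows "lin_ext (\<lambda>(a, b). scl (p (bas a)) (bas b)) (u \<otimes>\<^sub>\<rat> v) = scl (p u) v"
proof (rule lin_eq_bas[of "\<lambda>u. lin_ext (\<lambda>(a, b). scl (p (bas a)) (bas b)) (u \<otimes>\<^sub>\<rat> v)"])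
  fix a
  show "lin_ext (\<lambda>(a, b). scl (p (bas a)) (bas b)) (bas a \<otimes>\<^sub>\<rat> v) = scl (p (bas a)) v"
    by (rule lin_eq_bas[of "\<lambda>v. lin_ext (\<lambda>(a, b). scl (p (bas a)) (bas b)) (bas a \<otimes>\<^sub>\<rat> v)"])
      (auto intro!: lin_intros simp: tensor_bas)
qed (auto intro!: lin_intros lin_functional assms)

lemma lin_ext_eval_right:
  assumes "Vector_Spaces.linear scl (*) p"
  shows "lin_ext (\<lambda>(a, b). scl (p (bas b)) (bas a)) (u \<otimes>\<^sub>\<rat> v) = scl (p v) u"
proof (rule lin_eq_bas[of "\<lambda>u. lin_ext (\<lambda>(a, b). scl (p (bas b)) (bas a)) (u \<otimes>\<^sub>\<rat> v)"])
  fix a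
  show "lin_ext (\<lambda>(a, b). scl (p (bas b)) (bas a)) (bas a \<otimes>\<^sub>\<rat> v) = scl (p v) (bas a)"
    by (rule lin_eq_bas[of "\<lambda>v. lin_ext (\<lambda>(a, b). scl (p (bas b)) (bas a)) (bas a \<otimes>\<^sub>\<rat> v)"])
      (auto intro!: lin_intros lin_functional assms simp: tensor_bas)
qed (auto intro!: lin_intros lin_functional assms)

lemma mult_map_tensor:
  assumes "\<And>u. lin (m u)" "\<And>v. lin (\<lambda>u. m u v)"
  shows "mult_map m (u \<otimes>\<^sub>\<rat> v) = m u v"
proof (rule lin_eq_bas[of "\<lambda>u. mult_map m (u \<otimes>\<^sub>\<rat> v)"])
  fix a
  show "mult_map m (bas a \<otimes>\<^sub>\<rat> v) = m (bas a) v"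
    by (rule lin_eq_bas[of "\<lambda>v. mult_map m (bas a \<otimes>\<^sub>\<rat> v)"])
      (auto intro!: lin_intros assms simp: tensor_bas mult_map_def)
qed (auto intro!: lin_intros assms)

lemma tensor_mult_tensor:
  assumes l: "\<And>u. lin (m u)" "\<And>v. lin (\<lambda>u. m u v)"
  shows "tensor_mult m (u \<otimes>\<^sub>\<rat> v) (u' \<otimes>\<^sub>\<rat> v') = m u u' \<otimes>\<^sub>\<rat> m v v'"
proof -
  have 0: "tensor_mult m (bas (a, b)) (bas (c, d)) = m (bas a) (bas c) \<otimes>\<^sub>\<rat> m (bas b) (bas d)"
    for a b c d by (simp add: tensor_mult_def)
  have 1: "tensor_mult m (bas a \<otimes>\<^sub>\<rat> bas b) (u' \<otimes>\<^sub>\<rat> v') = m (bas a) u' \<otimes>\<^sub>\<rat> m (bas b) v'" for a b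
  proof (rule lin_eq_bas[of "\<lambda>u'. tensor_mult m (bas a \<otimes>\<^sub>\<rat> bas b) (u' \<otimes>\<^sub>\<rat> v')"])
    fix c
    show "tensor_mult m (bas a \<otimes>\<^sub>\<rat> bas b) (bas c \<otimes>\<^sub>\<rat> v') = m (bas a) (bas c) \<otimes>\<^sub>\<rat> m (bas b) v'"
      by (rule lin_eq_bas[of "\<lambda>v'. tensor_mult m (bas a \<otimes>\<^sub>\<rat> bas b) (bas c \<otimes>\<^sub>\<rat> v')"])
        (auto intro!: lin_intros l simp: tensor_bas 0)
  qed (auto intro!: lin_intros l)
  have 2: "tensor_mult m (bas a \<otimes>\<^sub>\<rat> v) (u' \<otimes>\<^sub>\<rat> v') = m (bas a) u' \<otimes>\<^sub>\<rat> m v v'" for a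
    by (rule lin_eq_bas[of "\<lambda>v. tensor_mult m (bas a \<otimes>\<^sub>\<rat> v) (u' \<otimes>\<^sub>\<rat> v')"])
      (auto intro!: lin_intros l simp: 1)
  show ?thesis
    by (rule lin_eq_bas[of "\<lambda>u. tensor_mult m (u \<otimes>\<^sub>\<rat> v) (u' \<otimes>\<^sub>\<rat> v')"])
      (auto intro!: lin_intros l simp: 2)
qed

section \<open>Bialgebras with the shuffle and deconcatenation recursions\<close>

text \<open>Abstracts the shuffle Hopf algebra on the alphabet \<open>'i\<close>: \<open>B n\<close>
  prepends the letter \<open>n\<close> and \<open>e w\<close> is the word \<open>w\<close>.
  \<open>m_B\<close> is the shuffle recursion, a Rota-Baxter type identity, and
  \<open>\<Delta>_B\<close> is the recursion of deconcatenation, a one-cocycle condition. Both are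
  stated for all vectors, so an instance may verify them in a basis other than
  \<open>e\<close>.\<close>

locale shuffle_bialgebra =
  fixes m :: "('b \<Rightarrow>\<^sub>0 rat) \<Rightarrow> ('b \<Rightarrow>\<^sub>0 rat) \<Rightarrow> ('b \<Rightarrow>\<^sub>0 rat)"
    and one :: "'b \<Rightarrow>\<^sub>0 rat"
    and B :: "'i \<Rightarrow> ('b \<Rightarrow>\<^sub>0 rat) \<Rightarrow> ('b \<Rightarrow>\<^sub>0 rat)"
    and \<Delta> :: "('b \<Rightarrow>\<^sub>0 rat) \<Rightarrow> ('b \<times> 'b \<Rightarrow>\<^sub>0 rat)"
    and \<epsilon> :: "('b \<Rightarrow>\<^sub>0 rat) \<Rightarrow> rat"
    and e :: "'i list \<Rightarrow> ('b \<Rightarrow>\<^sub>0 rat)"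
  assumes lin_m_right: "lin (m u)"
    and lin_m_left: "lin (\<lambda>u. m u v)"
    and one_left: "m one u = u"
    and one_right: "m u one = u"
    and lin_B: "lin (B n)"
    and m_B: "m (B k u) (B n v) = B k (m u (B n v)) + B n (m (B k u) v)"
    and e_Nil: "e [] = one"
    and e_Cons: "e (n # w) = B n (e w)"
    and bij_e: "bij (lin_ext e)"
    and lin_\<Delta>: "lin \<Delta>"
    and \<Delta>_one: "\<Delta> one = one \<otimes>\<^sub>\<rat> one"
    and \<Delta>_B: "\<Delta> (B n u) = one \<otimes>\<^sub>\<rat> B n u + tensor_map (B n) id (\<Delta> u)"
    and lin_\<epsilon>: "Vector_Spaces.linear scl (*) \<epsilon>"
    and \<epsilon>_one: "\<epsilon> one = 1"
    and \<epsilon>_B: "\<epsilon> (B n u) = 0"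
begin

section \<open>The bialgebra axioms, verified on the spanning words \<open>e w\<close>\<close>

lemma span_e: "fvs.span (range e) = UNIV"
proof -
  have "u \<in> fvs.span (range e)" for u
  proof -
    obtain x where "u = lin_ext e x" using bij_e by (metis bij_pointE)
    moreover have "lin_ext e x \<in> fvs.span (range e)"
      unfolding lin_ext_def by (intro fvs.span_sum fvs.span_scale fvs.span_base rangeI)
    ultimately show ?thesis by simp
  qed
  then show ?thesis by auto
qed

lemma lin_eq_e:
  assumes "lin f" "lin g" "\<And>w. f (e w) = g (e w)"
  shows "f u = g u"
  by (rule lin_eq_span[OF assms(1,2), of _ "range e"]) (auto simp: span_e assms)

lemma lin_m_right': "lin g \<Longrightarrow> lin (\<lambda>v. m u (g v))"
  by (rule lin_compose[OF lin_m_right])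

lemma lin_m_left': "lin g \<Longrightarrow> lin (\<lambda>u. m (g u) v)"
  by (rule lin_compose[OF lin_m_left])

lemma lin_B': "lin g \<Longrightarrow> lin (\<lambda>u. B n (g u))"
  by (rule lin_compose[OF lin_B])

lemma lin_\<Delta>': "lin g \<Longrightarrow> lin (\<lambda>u. \<Delta> (g u))"
  by (rule lin_compose[OF lin_\<Delta>])

lemmas m_lin = lin_m_right' lin_m_left' lin_B' lin_\<Delta>' lin_B lin_\<Delta> lin_intros

lemmas m_add_left = lin_add[OF lin_m_left]
lemmas m_add_right = lin_add[OF lin_m_right]
lemmas B_add = lin_add[OF lin_B]
lemmas m_tensor = tensor_mult_tensor[OF lin_m_right lin_m_left]

text \<open>Induction on the total length: expanded by \<open>m_B\<close>, both bracketings become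
  the same sum of three terms, one for each word that can supply the first letter.\<close>

lemma m_assoc_e: "m (m (e u) (e v)) (e w) = m (e u) (m (e v) (e w))"
proof (induction "length u + length v + length w" arbitrary: u v w rule: less_induct)
  case less
  show ?case
  proof (cases "u = [] \<or> v = [] \<or> w = []")
    case True
    then show ?thesis by (auto simp: e_Nil one_left one_right)
  next
    case False
    then obtain a u' b v' c w' where eq: "u = a # u'" "v = b # v'" "w = c # w'"
      by (auto simp: neq_Nil_conv)
    have 1: "m (m (e u') (e v)) (e w) = m (e u') (m (e v) (e w))"
      "m (m (e u) (e v')) (e w) = m (e u) (m (e v') (e w))"
      "m (m (e u) (e v)) (e w') = m (e u) (m (e v) (e w'))"
      by (rule less; simp add: eq)+
    have "m (m (e u) (e v)) (e w) =
        B a (m (m (e u') (e v)) (e w)) + B b (m (m (e u) (e v')) (e w))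
        + B c (m (m (e u) (e v)) (e w'))"
      by (simp add: eq e_Cons m_B m_add_left B_add)
    also have "\<dots> = m (e u) (m (e v) (e w))"
      unfolding 1 by (simp add: eq e_Cons m_B m_add_right B_add)
    finally show ?thesis .
  qed
qed

lemma m_assoc: "m (m u v) w = m u (m v w)"
proof (rule lin_eq_e[of "\<lambda>u. m (m u v) w"])
  fix a
  show "m (m (e a) v) w = m (e a) (m v w)"
  proof (rule lin_eq_e[of "\<lambda>v. m (m (e a) v) w"])
    fix b
    show "m (m (e a) (e b)) w = m (e a) (m (e b) w)"
      by (rule lin_eq_e[of "\<lambda>w. m (m (e a) (e b)) w"]) (auto intro!: m_lin simp: m_assoc_e)
  qed (auto intro!: m_lin)
qed (auto intro!: m_lin)

text \<open>The operators \<open>tensor_map (B k) id\<close> touch only left factors, so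
  \<open>m_B\<close> there gives the same recursion on the tensor square.\<close>

lemma tensor_mult_B:
  "tensor_mult m (tensor_map (B k) id x) (tensor_map (B n) id y) =
    tensor_map (B k) id (tensor_mult m x (tensor_map (B n) id y)) +
    tensor_map (B n) id (tensor_mult m (tensor_map (B k) id x) y)"
proof (rule lin_eq_tensor[of "\<lambda>x. tensor_mult m (tensor_map (B k) id x) (tensor_map (B n) id y)"])
  fix u v
  show "tensor_mult m (tensor_map (B k) id (u \<otimes>\<^sub>\<rat> v)) (tensor_map (B n) id y) =
    tensor_map (B k) id (tensor_mult m (u \<otimes>\<^sub>\<rat> v) (tensor_map (B n) id y)) +
    tensor_map (B n) id (tensor_mult m (tensor_map (B k) id (u \<otimes>\<^sub>\<rat> v)) y)"
    by (rule lin_eq_tensor[of "\<lambda>y. tensor_mult m (tensor_map (B k) id (u \<otimes>\<^sub>\<rat> v)) (tensor_map (B n) id y)"])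
      (auto intro!: m_lin simp: tensor_map_tensor lin_B lin_id lin_ident m_tensor m_B tensor_add_left)
qed (auto intro!: m_lin)

lemma tensor_mult_one_B_left:
  "tensor_mult m (one \<otimes>\<^sub>\<rat> u) (tensor_map (B n) id y) =
    tensor_map (B n) id (tensor_mult m (one \<otimes>\<^sub>\<rat> u) y)"
  by (rule lin_eq_tensor[of "\<lambda>y. tensor_mult m (one \<otimes>\<^sub>\<rat> u) (tensor_map (B n) id y)"])
    (auto intro!: m_lin simp: tensor_map_tensor lin_B lin_id lin_ident m_tensor one_left)

lemma tensor_mult_one_B_right:
  "tensor_mult m (tensor_map (B n) id y) (one \<otimes>\<^sub>\<rat> u) =
    tensor_map (B n) id (tensor_mult m y (one \<otimes>\<^sub>\<rat> u))"
  by (rule lin_eq_tensor[of "\<lambda>y. tensor_mult m (tensor_map (B n) id y) (one \<otimes>\<^sub>\<rat> u)"])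
    (auto intro!: m_lin simp: tensor_map_tensor lin_B lin_id lin_ident m_tensor one_right)

lemma tensor_mult_one_left: "tensor_mult m (one \<otimes>\<^sub>\<rat> one) y = y"
  by (rule lin_eq_tensor[of "\<lambda>y. tensor_mult m (one \<otimes>\<^sub>\<rat> one) y"])
    (auto intro!: m_lin simp: m_tensor one_left)

lemma tensor_mult_one_right: "tensor_mult m y (one \<otimes>\<^sub>\<rat> one) = y"
  by (rule lin_eq_tensor[of "\<lambda>y. tensor_mult m y (one \<otimes>\<^sub>\<rat> one)"])
    (auto intro!: m_lin simp: m_tensor one_right)

text \<open>Induction on the total length. The two summands with \<open>one\<close> on the left
  multiply to \<open>one\<close> tensor the product; the remaining terms regroup by
  \<open>tensor_mult_B\<close> and the two mixed rules into the images of the shorter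
  products.\<close>

lemma \<Delta>_m_e: "\<Delta> (m (e u) (e v)) = tensor_mult m (\<Delta> (e u)) (\<Delta> (e v))"
proof (induction "length u + length v" arbitrary: u v rule: less_induct)
  case less
  show ?case
  proof (cases "u = [] \<or> v = []")
    case True
    then show ?thesis
      by (auto simp: e_Nil one_left one_right \<Delta>_one tensor_mult_one_left tensor_mult_one_right)
  next
    case False
    then obtain a u' b v' where eq: "u = a # u'" "v = b # v'"
      by (auto simp: neq_Nil_conv)
    have 1: "\<Delta> (m (e u') (e v)) = tensor_mult m (\<Delta> (e u')) (\<Delta> (e v))"
      "\<Delta> (m (e u) (e v')) = tensor_mult m (\<Delta> (e u)) (\<Delta> (e v'))"
      by (rule less; simp add: eq)+
    note add = tensor_mult_add_left tensor_mult_add_right tensor_map_add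
    have "\<Delta> (m (e u) (e v)) = one \<otimes>\<^sub>\<rat> m (e u) (e v)
        + tensor_map (B a) id (\<Delta> (m (e u') (e v))) + tensor_map (B b) id (\<Delta> (m (e u) (e v')))"
      by (simp add: eq e_Cons m_B \<Delta>_B lin_add[OF lin_\<Delta>] tensor_add_right)
    also have "\<dots> = tensor_mult m (\<Delta> (e u)) (\<Delta> (e v))"
      unfolding 1
      by (simp add: eq e_Cons \<Delta>_B add tensor_mult_B tensor_mult_one_B_left
          tensor_mult_one_B_right m_tensor one_left)
    finally show ?thesis .
  qed
qed

lemma \<Delta>_m: "\<Delta> (m u v) = tensor_mult m (\<Delta> u) (\<Delta> v)"
proof (rule lin_eq_e[of "\<lambda>u. \<Delta> (m u v)"])
  fix a
  show "\<Delta> (m (e a) v) = tensor_mult m (\<Delta> (e a)) (\<Delta> v)"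
    by (rule lin_eq_e[of "\<lambda>v. \<Delta> (m (e a) v)"]) (auto intro!: m_lin simp: \<Delta>_m_e)
qed (auto intro!: m_lin)

lemma coassoc_e: "tensor_assoc (tensor_map \<Delta> id (\<Delta> (e w))) = tensor_map id \<Delta> (\<Delta> (e w))"
proof (induction w)
  case Nil
  then show ?case
    by (simp add: e_Nil \<Delta>_one tensor_map_tensor lin_id lin_ident lin_\<Delta> tensor_assoc_tensor)
next
  case (Cons n w)
  note add = tensor_map_add tensor_assoc_add
  have comm: "tensor_assoc (tensor_map (B n) id y \<otimes>\<^sub>\<rat> z) = tensor_map (B n) id (tensor_assoc (y \<otimes>\<^sub>\<rat> z))"
    for y :: "'b \<times> 'b \<Rightarrow>\<^sub>0 rat" and z :: "'b \<Rightarrow>\<^sub>0 rat"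
    by (rule lin_eq_tensor[of "\<lambda>y. tensor_assoc (tensor_map (B n) id y \<otimes>\<^sub>\<rat> z)"])
      (auto intro!: m_lin simp: tensor_map_tensor lin_B lin_id lin_ident tensor_assoc_tensor)
  \<comment> \<open>The cocycle term of the inner \<open>\<Delta>\<close> produces the summand
    starting with \<open>one\<close>. On the other side of coassociativity it comes from expanding
    \<open>\<Delta> (B n _)\<close> in the right factor.\<close>
  have left: "tensor_assoc (tensor_map \<Delta> id (tensor_map (B n) id x)) =
      one \<otimes>\<^sub>\<rat> tensor_map (B n) id x + tensor_map (B n) id (tensor_assoc (tensor_map \<Delta> id x))"
    for x :: "'b \<times> 'b \<Rightarrow>\<^sub>0 rat"
  proof (rule lin_eq_tensor[of "\<lambda>x. tensor_assoc (tensor_map \<Delta> id (tensor_map (B n) id x))"])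
    fix y z :: "'b \<Rightarrow>\<^sub>0 rat"
    show "tensor_assoc (tensor_map \<Delta> id (tensor_map (B n) id (y \<otimes>\<^sub>\<rat> z))) =
      one \<otimes>\<^sub>\<rat> tensor_map (B n) id (y \<otimes>\<^sub>\<rat> z) + tensor_map (B n) id (tensor_assoc (tensor_map \<Delta> id (y \<otimes>\<^sub>\<rat> z)))"
      by (simp add: tensor_map_tensor lin_B lin_id lin_ident lin_\<Delta> \<Delta>_B tensor_add_left add
          tensor_assoc_tensor comm)
  qed (auto intro!: m_lin)
  have right: "tensor_map id \<Delta> (tensor_map (B n) id x) = tensor_map (B n) id (tensor_map id \<Delta> x)"
    for x :: "'b \<times> 'b \<Rightarrow>\<^sub>0 rat"
    by (rule lin_eq_tensor[of "\<lambda>x. tensor_map id \<Delta> (tensor_map (B n) id x)"])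
      (auto intro!: m_lin simp: tensor_map_tensor lin_B lin_id lin_ident lin_\<Delta>)
  show ?case
    using Cons[unfolded id_def]
    by (simp add: id_def e_Cons \<Delta>_B[unfolded id_def] add tensor_map_tensor lin_ident lin_\<Delta> \<Delta>_one
        left[unfolded id_def] right[unfolded id_def] tensor_assoc_tensor tensor_add_right)
qed

lemma coassoc: "tensor_assoc (tensor_map \<Delta> id (\<Delta> u)) = tensor_map id \<Delta> (\<Delta> u)"
  by (rule lin_eq_e[of "\<lambda>u. tensor_assoc (tensor_map \<Delta> id (\<Delta> u))" "\<lambda>u. tensor_map id \<Delta> (\<Delta> u)"])
    (auto intro!: m_lin coassoc_e)

lemma counit_left: "lin_ext (\<lambda>(a, b). scl (\<epsilon> (bas a)) (bas b)) (\<Delta> u) = u"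
proof (rule lin_eq_e[of "\<lambda>u. lin_ext (\<lambda>(a, b). scl (\<epsilon> (bas a)) (bas b)) (\<Delta> u)"])
  fix w
  have *: "lin_ext (\<lambda>(a, b). scl (\<epsilon> (bas a)) (bas b)) (tensor_map (B n) id x) = 0" for n x
    by (rule lin_eq_tensor[of "\<lambda>x. lin_ext (\<lambda>(a, b). scl (\<epsilon> (bas a)) (bas b)) (tensor_map (B n) id x)"])
      (auto intro!: m_lin simp: tensor_map_tensor lin_B lin_id lin_ident lin_ext_eval_left[OF lin_\<epsilon>] \<epsilon>_B)
  show "lin_ext (\<lambda>(a, b). scl (\<epsilon> (bas a)) (bas b)) (\<Delta> (e w)) = e w"
    by (cases w) (simp_all add: e_Nil e_Cons \<Delta>_one \<Delta>_B lin_ext_eval_left[OF lin_\<epsilon>] \<epsilon>_one *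
        lin_add[OF linear_lin_ext])
qed (auto intro!: m_lin)

text \<open>Here the cocycle term dies because \<open>\<epsilon>\<close> kills \<open>B n\<close>,
  and contracting the right factor commutes with \<open>B n\<close>; hence an induction, where
  \<open>counit_left\<close> needs only a case split.\<close>

lemma counit_right: "lin_ext (\<lambda>(a, b). scl (\<epsilon> (bas b)) (bas a)) (\<Delta> u) = u"
proof (rule lin_eq_e[of "\<lambda>u. lin_ext (\<lambda>(a, b). scl (\<epsilon> (bas b)) (bas a)) (\<Delta> u)"])
  fix w
  have *: "lin_ext (\<lambda>(a, b). scl (\<epsilon> (bas b)) (bas a)) (tensor_map (B n) id x) =
      B n (lin_ext (\<lambda>(a, b). scl (\<epsilon> (bas b)) (bas a)) x)" for n x
    by (rule lin_eq_tensor[of "\<lambda>x. lin_ext (\<lambda>(a, b). scl (\<epsilon> (bas b)) (bas a)) (tensor_map (B n) id x)"])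
      (auto intro!: m_lin simp: tensor_map_tensor lin_B lin_id lin_ident lin_ext_eval_right[OF lin_\<epsilon>]
        lin_scl[OF lin_B])
  show "lin_ext (\<lambda>(a, b). scl (\<epsilon> (bas b)) (bas a)) (\<Delta> (e w)) = e w"
    by (induction w) (simp_all add: e_Nil e_Cons \<Delta>_one \<Delta>_B lin_ext_eval_right[OF lin_\<epsilon>] \<epsilon>_one \<epsilon>_B *
        lin_add[OF linear_lin_ext])
qed (auto intro!: m_lin)

lemma \<epsilon>_m: "\<epsilon> (m u v) = \<epsilon> u * \<epsilon> v"
proof -
  have add: "\<epsilon> (u + v) = \<epsilon> u + \<epsilon> v" for u v
    using lin_\<epsilon> by (auto simp: Vector_Spaces.linear_iff)
  have 1: "\<epsilon> (m (e u) (e v)) = \<epsilon> (e u) * \<epsilon> (e v)" for u v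
    by (cases u; cases v) (simp_all add: e_Nil e_Cons one_left one_right \<epsilon>_one \<epsilon>_B m_B add)
  \<comment> \<open>The extensionality rules compare maps into free spaces, so scalars are compared
    as multiples of \<open>one\<close>, which is nonzero because
    \<open>\<epsilon> one = 1\<close>.\<close>
  note scl_\<epsilon> = lin_compose[OF lin_functional[OF lin_\<epsilon>]]
  have 2: "scl (\<epsilon> (m (e w) v)) one = scl (\<epsilon> (e w)) (scl (\<epsilon> v) one)" for w
    by (rule lin_eq_e[of "\<lambda>v. scl (\<epsilon> (m (e w) v)) one"])
      (use 1 in \<open>auto intro: scl_\<epsilon> lin_m_right lin_scale lin_functional[OF lin_\<epsilon>] simp del: fvs.scale_scale simp: fvs.scale_scale[symmetric]\<close>)
  have 3: "scl (\<epsilon> (m u v)) one = scl (\<epsilon> v) (scl (\<epsilon> u) one)"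
    by (rule lin_eq_e[of "\<lambda>u. scl (\<epsilon> (m u v)) one"])
      (use 2 in \<open>auto intro: scl_\<epsilon> lin_m_left lin_scale lin_functional[OF lin_\<epsilon>] simp del: fvs.scale_scale simp: fvs.scale_left_commute\<close>)
  have "one \<noteq> 0"
    using \<epsilon>_one add[of 0 0] by auto
  with 3 show ?thesis
    by (simp add: mult.commute)
qed

lemma is_bialgebra: "bialgebra m \<Delta> one \<epsilon>"
  unfolding bialgebra_def unital_algebra_def coalgebra_def
  by (auto simp: lin_m_left lin_m_right m_assoc one_left one_right lin_\<Delta> lin_\<epsilon> coassoc
      counit_left counit_right \<Delta>_m \<Delta>_one \<epsilon>_m \<epsilon>_one)

text \<open>Convolution for deconcatenation: it runs over all splittings \<open>w = u @ v\<close>.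
  The letters already moved into the prefix are absorbed into \<open>a\<close>, which avoids
  indices.\<close>

primrec conv :: "('i list \<Rightarrow> ('b \<Rightarrow>\<^sub>0 rat)) \<Rightarrow> ('i list \<Rightarrow> ('b \<Rightarrow>\<^sub>0 rat)) \<Rightarrow> 'i list \<Rightarrow> ('b \<Rightarrow>\<^sub>0 rat)"
where
  "conv a b [] = m (a []) (b [])"
| "conv a b (x # w) = m (a []) (b (x # w)) + conv (\<lambda>u. a (x # u)) b w"

lemma conv_plus: "conv (\<lambda>u. a u + a' u) b w = conv a b w + conv a' b w"
  by (induction w arbitrary: a a') (simp_all add: m_add_left algebra_simps)

lemma conv_uminus: "conv (\<lambda>u. - a u) b w = - conv a b w"
  by (induction w arbitrary: a) (simp_all add: lin_uminus[OF lin_m_left])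

lemma conv_m: "conv (\<lambda>u. m x (a u)) b w = m x (conv a b w)"
  by (induction w arbitrary: a) (simp_all add: m_assoc m_add_right)

lemma conv_assoc: "conv (conv a b) c w = conv a (conv b c) w"
proof (induction w arbitrary: a b)
  case Nil
  then show ?case by (simp add: m_assoc)
next
  case (Cons x w)
  then show ?case by (simp add: conv_plus conv_m m_assoc m_add_right algebra_simps)
qed

text \<open>All suffixes are at most as long as \<open>w\<close>, so a strong induction on length
  can use its hypothesis inside a convolution.\<close>

lemma conv_cong_right:
  "(\<And>v. length v \<le> length w \<Longrightarrow> b v = b' v) \<Longrightarrow> conv a b w = conv a b' w"
  by (induction w arbitrary: a) simp_all

definition unit_word :: "'i list \<Rightarrow> ('b \<Rightarrow>\<^sub>0 rat)" where
  "unit_word w = (if w = [] then one else 0)"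

lemma conv_unit_right: "conv a unit_word w = a w"
  by (induction w arbitrary: a) (simp_all add: unit_word_def one_right lin_0[OF lin_m_right])

lemma conv_zero: "conv (\<lambda>u. 0) b w = 0"
  by (induction w) (simp_all add: lin_0[OF lin_m_left])

lemma conv_unit_left: "conv unit_word b w = b w"
  by (cases w) (simp_all add: unit_word_def one_left conv_zero)

text \<open>Identifies the convolution of linear maps with \<open>conv\<close>. The map
  \<open>f\<close> is generalised because the letter split off by \<open>\<Delta>_B\<close> turns it
  into \<open>f\<close> composed with \<open>B x\<close>.\<close>

lemma mult_map_conv:
  assumes "lin f" "lin g"
  shows "mult_map m (tensor_map f g (\<Delta> (e w))) = conv (\<lambda>u. f (e u)) (\<lambda>u. g (e u)) w"
  using assms(1)
proof (induction w arbitrary: f)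
  case Nil
  then show ?case
    by (simp add: e_Nil \<Delta>_one tensor_map_tensor assms mult_map_tensor lin_m_left lin_m_right)
next
  case (Cons x w)
  note f = Cons.prems
  have fB: "lin (\<lambda>u. f (B x u))" by (rule lin_compose[OF f lin_B])
  have *: "tensor_map f g (tensor_map (B x) id y) = tensor_map (\<lambda>u. f (B x u)) g y" for y
    by (rule lin_eq_tensor[of "\<lambda>y. tensor_map f g (tensor_map (B x) id y)"])
      (auto intro!: m_lin simp: tensor_map_tensor lin_B lin_id lin_ident f fB assms)
  note add = tensor_map_add mult_map_add
  show ?case
    by (simp add: e_Cons \<Delta>_B add * Cons.IH[OF fB] tensor_map_tensor f assms mult_map_tensor
        lin_m_left lin_m_right e_Nil)
qed

definition antip_word :: "'i list \<Rightarrow> ('b \<Rightarrow>\<^sub>0 rat)" where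
  "antip_word w = scl ((-1) ^ length w) (e (rev w))"

text \<open>By the shuffle recursion each product \<open>rev u \<cdot> v\<close> splits into two terms, each of which cancels against a
  neighbouring summand of the alternating sum.\<close>

lemma conv_rev_e:
  "conv (\<lambda>u. scl ((-1) ^ length u) (e (rev u @ y # p))) e w = B y (m (e p) (e w))"
proof (induction w arbitrary: y p)
  case Nil
  then show ?case by (simp add: e_Nil one_left one_right e_Cons)
next
  case (Cons x w)
  have "conv (\<lambda>u. scl ((-1) ^ length (x # u)) (e (rev (x # u) @ y # p))) e w =
      - conv (\<lambda>u. scl ((-1) ^ length u) (e (rev u @ x # y # p))) e w"
    by (simp add: conv_uminus[symmetric])
  then show ?case by (simp add: Cons e_Cons m_B)
qed

text \<open>The empty prefix contributes \<open>e w\<close>; the other prefixes add up to its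
  negative by \<open>conv_rev_e\<close> with \<open>p = []\<close>.\<close>

lemma conv_antip_left: "conv antip_word e w = unit_word w"
proof (cases w)
  case Nil
  then show ?thesis by (simp add: antip_word_def unit_word_def e_Nil one_left)
next
  case (Cons x v)
  have "conv (\<lambda>u. antip_word (x # u)) e v =
      - conv (\<lambda>u. scl ((-1) ^ length u) (e (rev u @ x # []))) e v"
    by (simp add: antip_word_def conv_uminus[symmetric])
  also have "\<dots> = - e (x # v)"
    by (simp only: conv_rev_e) (simp add: e_Nil one_left one_right e_Cons)
  finally show ?thesis
    using Cons by (simp add: antip_word_def unit_word_def e_Nil one_left one_right)
qed

text \<open>Convolution is associative, so the left inverse of \<open>e\<close> is also a right inverse.\<close>

lemma conv_antip_right: "conv e antip_word w = unit_word w"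
proof (induction "length w" arbitrary: w rule: less_induct)
  case less
  show ?case
  proof (cases w)
    case Nil
    then show ?thesis by (simp add: antip_word_def unit_word_def e_Nil one_left)
  next
    case (Cons x v)
    \<comment> \<open>By induction the proper suffixes of \<open>w\<close> already give
      \<open>unit_word\<close>, so only \<open>conv e antip_word w\<close> and the term of the full
      prefix survive.\<close>
    have "conv (\<lambda>u. antip_word (x # u)) (conv e antip_word) v =
        conv (\<lambda>u. antip_word (x # u)) unit_word v"
      by (rule conv_cong_right) (use less Cons in auto)
    then have "conv antip_word (conv e antip_word) w = conv e antip_word w + antip_word w"
      unfolding Cons by (simp add: conv_unit_right antip_word_def e_Nil one_left one_right)
    moreover have "conv antip_word (conv e antip_word) w = conv unit_word antip_word w"
      unfolding conv_assoc[symmetric] by (simp add: conv_antip_left[abs_def])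
    ultimately show ?thesis
      using Cons by (simp only: conv_unit_left) (simp add: unit_word_def)
  qed
qed

lemma ex_antipode: "\<exists>S. antipode m \<Delta> one \<epsilon> S"
proof
  define S where "S u = lin_ext antip_word (inv (lin_ext e) u)" for u
  have inv_e: "inv (lin_ext e) (lin_ext e x) = x" for x
    using bij_e by (simp add: bij_is_inj)
  have S: "lin S"
    unfolding S_def by (intro lin_intros lin_inv_lin_ext bij_e)
  have "inv (lin_ext e) (e w) = bas w" for w
    using inv_e[of "bas w"] by simp
  then have Se: "S (e w) = antip_word w" for w
    by (simp add: S_def)
  have unit: "scl (\<epsilon> (e w)) one = unit_word w" for w
    by (cases w) (simp_all add: e_Nil e_Cons \<epsilon>_one \<epsilon>_B unit_word_def)
  have "mult_map m (tensor_map S id (\<Delta> u)) = scl (\<epsilon> u) one" for u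
    by (rule lin_eq_e[of "\<lambda>u. mult_map m (tensor_map S id (\<Delta> u))"])
      (auto intro!: m_lin lin_functional lin_\<epsilon> simp: mult_map_conv[OF S lin_id] Se unit
        conv_antip_left[unfolded antip_word_def] antip_word_def)
  moreover have "mult_map m (tensor_map id S (\<Delta> u)) = scl (\<epsilon> u) one" for u
    by (rule lin_eq_e[of "\<lambda>u. mult_map m (tensor_map id S (\<Delta> u))"])
      (auto intro!: m_lin lin_functional lin_\<epsilon> simp: mult_map_conv[OF lin_id S] Se unit conv_antip_right)
  ultimately show "antipode m \<Delta> one \<epsilon> S"
    unfolding antipode_def using S by blast
qed

lemma is_hopf_algebra: "hopf_algebra m \<Delta> one \<epsilon>"
  unfolding hopf_algebra_def using is_bialgebra ex_antipode by blast

end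

section \<open>The shuffle algebra in two letters\<close>

definition strip :: "letter \<Rightarrow> (letter list \<Rightarrow>\<^sub>0 rat) \<Rightarrow> (letter list \<Rightarrow>\<^sub>0 rat)" where
  "strip a = lin_ext (\<lambda>w. case w of [] \<Rightarrow> 0 | b # v \<Rightarrow> if b = a then bas v else 0)"

lemma lin_strip: "lin h \<Longrightarrow> lin (\<lambda>u. strip a (h u))"
  unfolding strip_def by (rule lin_lin_ext)

lemma strip_add: "strip a (u + v) = strip a u + strip a v"
  unfolding strip_def by (rule lin_add[OF linear_lin_ext])

lemma strip_bas: "strip a (bas []) = 0" "strip a (bas (b # v)) = (if b = a then bas v else 0)"
  by (simp_all add: strip_def)

lemma lin_prepend: "lin h \<Longrightarrow> lin (\<lambda>u. prepend a (h u))"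
  unfolding prepend_def by (rule lin_lin_ext)

lemma prepend_bas: "prepend a (bas w) = bas (a # w)"
  by (simp add: prepend_def)

lemma strip_prepend: "strip a (prepend b u) = (if b = a then u else 0)"
  by (rule lin_eq_bas[of "\<lambda>u. strip a (prepend b u)" "\<lambda>u. if b = a then u else 0"])
    (auto intro!: lin_strip lin_prepend lin_intros simp: prepend_bas strip_bas)

lemma lookup_strip: "Poly_Mapping.lookup (strip a u) w = Poly_Mapping.lookup u (a # w)"
proof -
  \<comment> \<open>Scalars become vectors over a one-element basis, because
    \<open>lin_eq_bas\<close> compares maps into free spaces.\<close>
  have "scl (Poly_Mapping.lookup (strip a u) w) (bas ()) = scl (Poly_Mapping.lookup u (a # w)) (bas ())"
  proof (rule lin_eq_bas[of "\<lambda>u. scl (Poly_Mapping.lookup (strip a u) w) (bas ())"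
        "\<lambda>u. scl (Poly_Mapping.lookup u (a # w)) (bas ())"])
    fix v
    show "scl (Poly_Mapping.lookup (strip a (bas v)) w) (bas ()) =
        scl (Poly_Mapping.lookup (bas v) (a # w)) (bas ())"
      by (cases v) (auto simp: strip_bas, auto simp: bas_def lookup_single when_def)
  qed (auto intro!: linI simp: lookup_add strip_add fvs.scale_left_distrib
      lin_scl[OF lin_strip[OF lin_ident]])
  then show ?thesis
    by (auto simp: bas_def dest!: arg_cong[where f = "\<lambda>u. Poly_Mapping.lookup u ()"])
qed

lemma eq_by_strip:
  assumes "\<And>a. strip a u = strip a v" "Poly_Mapping.lookup u [] = Poly_Mapping.lookup v []"
  shows "u = v"
proof (rule poly_mapping_eqI)
  fix w show "Poly_Mapping.lookup u w = Poly_Mapping.lookup v w"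
    using assms by (cases w) (auto simp: lookup_strip[symmetric])
qed

lemma lin_shuffle_left: "lin h \<Longrightarrow> lin (\<lambda>u. shuffle (h u) v)"
  unfolding shuffle_def by (rule lin_bilin_ext_left)

lemma lin_shuffle_right: "lin h \<Longrightarrow> lin (\<lambda>v. shuffle u (h v))"
  unfolding shuffle_def by (rule lin_bilin_ext_right)

lemma shuffle_words_Nil2: "shuffle_words u [] = bas u"
  by (cases u) simp_all

lemma shuffle_bas: "shuffle (bas u) (bas v) = shuffle_words u v"
  by (simp add: shuffle_def)

lemma shuffle_one_left: "shuffle (bas []) u = u"
  by (rule lin_eq_bas[of "\<lambda>u. shuffle (bas []) u"])
    (auto intro!: lin_shuffle_right lin_ident simp: shuffle_bas)

lemma shuffle_one_right: "shuffle u (bas []) = u"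
  by (rule lin_eq_bas[of "\<lambda>u. shuffle u (bas [])"])
    (auto intro!: lin_shuffle_left lin_ident simp: shuffle_bas shuffle_words_Nil2)

lemma shuffle_zero: "shuffle 0 u = 0" "shuffle u 0 = 0"
  by (rule lin_0[OF lin_shuffle_left[OF lin_ident]], rule lin_0[OF lin_shuffle_right[OF lin_ident]])

text \<open>The first letter of a shuffle comes from one factor or the other; the two summands of
  the shuffle recursion are these two cases.\<close>

lemma strip_shuffle: "strip a (shuffle u v) = shuffle (strip a u) v + shuffle u (strip a v)"
proof (rule lin_eq_bas[of "\<lambda>u. strip a (shuffle u v)" "\<lambda>u. shuffle (strip a u) v + shuffle u (strip a v)"])
  fix x
  show "strip a (shuffle (bas x) v) = shuffle (strip a (bas x)) v + shuffle (bas x) (strip a v)"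
  proof (rule lin_eq_bas[of "\<lambda>v. strip a (shuffle (bas x) v)"
        "\<lambda>v. shuffle (strip a (bas x)) v + shuffle (bas x) (strip a v)"])
    fix y
    show "strip a (shuffle (bas x) (bas y)) =
        shuffle (strip a (bas x)) (bas y) + shuffle (bas x) (strip a (bas y))"
    proof (cases "x = [] \<or> y = []")
      case True
      then show ?thesis
        by (auto simp: shuffle_one_left shuffle_one_right strip_bas shuffle_zero)
    next
      case False
      then show ?thesis
        by (auto simp: neq_Nil_conv strip_bas shuffle_zero strip_add strip_prepend)
          (auto simp: shuffle_def strip_add strip_prepend)
    qed
  qed (auto intro!: lin_strip lin_shuffle_left lin_shuffle_right lin_intros)
qed (auto intro!: lin_strip lin_shuffle_left lin_shuffle_right lin_intros)

lemma lookup_prepend_Nil: "Poly_Mapping.lookup (prepend a u) [] = 0"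
  by (auto simp: prepend_def lin_ext_def lookup_sum bas_def lookup_single)

text \<open>Supplies the constant coefficient, which \<open>strip\<close> cannot see: shuffling with
  a nonempty word never gives the empty one.\<close>

lemma lookup_shuffle_Nil:
  fixes u v :: "'a list \<Rightarrow>\<^sub>0 rat"
  assumes u: "Poly_Mapping.lookup u [] = 0"
  shows "Poly_Mapping.lookup (shuffle u v) [] = 0"
proof -
  have *: "Poly_Mapping.lookup (shuffle_words x y) [] = 0" if "x \<noteq> []" for x y :: "'a list"
    using that by (cases x; cases y) (auto simp: lookup_add lookup_prepend_Nil bas_def lookup_single)
  then show ?thesis
    using u unfolding shuffle_def bilin_ext_def lin_ext_def lookup_sum
    by (auto simp: lookup_sum intro!: sum.neutral) (metis *)
qed

text \<open>In the polynomial picture, \<open>ins_word n\<close> is \<open>f \<mapsto> X\<^sub>1\<^sup>n/n! f(X\<^sub>1 + X\<^sub>2, X\<^sub>3, \<dots>)\<close>.\<close>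

fun ins_word :: "nat \<Rightarrow> letter list \<Rightarrow> (letter list \<Rightarrow>\<^sub>0 rat)" where
  "ins_word 0 [] = bas [X1]"
| "ins_word 0 (X1 # w) = bas (X1 # X1 # w)"
| "ins_word 0 (X0 # w) = bas (X1 # X0 # w) + prepend X0 (ins_word 0 w)"
| "ins_word (Suc n) [] = prepend X0 (ins_word n [])"
| "ins_word (Suc n) (X1 # w) = prepend X0 (ins_word n (X1 # w))"
| "ins_word (Suc n) (X0 # w) = prepend X0 (ins_word n (X0 # w) + ins_word (Suc n) w)"

definition ins :: "nat \<Rightarrow> (letter list \<Rightarrow>\<^sub>0 rat) \<Rightarrow> (letter list \<Rightarrow>\<^sub>0 rat)" where
  "ins n = lin_ext (ins_word n)"

lemma lin_ins: "lin h \<Longrightarrow> lin (\<lambda>u. ins n (h u))"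
  unfolding ins_def by (rule lin_lin_ext)

lemma ins_add: "ins n (u + v) = ins n u + ins n v"
  unfolding ins_def by (rule lin_add[OF linear_lin_ext])

lemma ins_zero: "ins n 0 = 0"
  unfolding ins_def by (rule lin_0[OF linear_lin_ext])

lemma ins_bas: "ins n (bas w) = ins_word n w"
  by (simp add: ins_def)

text \<open>With \<open>strip_X0_ins\<close> this describes \<open>ins n\<close> by leading letters:
  \<open>strip X0\<close> commutes with \<open>ins n\<close> up to \<open>ins (n - 1)\<close>.
  Besides linearity and the missing constant term, the shuffle recursion uses only these two facts
  about \<open>ins\<close>.\<close>

lemma strip_X1_ins: "strip X1 (ins n u) = (if n = 0 then u else 0)"
proof (rule lin_eq_bas[of "\<lambda>u. strip X1 (ins n u)" "\<lambda>u. if n = 0 then u else 0"])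
  fix w
  show "strip X1 (ins n (bas w)) = (if n = 0 then bas w else 0)"
    unfolding ins_bas
    by (cases "(n, w)" rule: ins_word.cases) (simp_all add: strip_bas strip_add strip_prepend)
qed (auto intro!: lin_strip lin_ins lin_intros)

lemma strip_X0_ins:
  "strip X0 (ins n u) = (if n = 0 then 0 else ins (n - 1) u) + ins n (strip X0 u)"
proof (rule lin_eq_bas[of "\<lambda>u. strip X0 (ins n u)"
      "\<lambda>u. (if n = 0 then 0 else ins (n - 1) u) + ins n (strip X0 u)"])
  fix w
  show "strip X0 (ins n (bas w)) =
      (if n = 0 then 0 else ins (n - 1) (bas w)) + ins n (strip X0 (bas w))"
    unfolding ins_bas
    by (cases "(n, w)" rule: ins_word.cases)
      (simp_all add: strip_bas strip_add strip_prepend ins_bas ins_zero)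
qed (auto intro!: lin_strip lin_ins lin_intros)

lemma lookup_ins_Nil: "Poly_Mapping.lookup (ins n u) [] = 0"
proof -
  have "Poly_Mapping.lookup (ins_word n w) [] = 0" for w
    by (cases "(n, w)" rule: ins_word.cases)
      (simp_all add: lookup_prepend_Nil lookup_add, simp_all add: bas_def lookup_single)
  then show ?thesis by (simp add: ins_def lin_ext_def lookup_sum)
qed

text \<open>Compare both sides under the two derivations. \<open>strip X1\<close> gives equal terms
  at once; \<open>strip X0\<close> gives instances of the same identity with \<open>k\<close>,
  \<open>n\<close> or one word made smaller, so induction on the total size applies.\<close>

lemma shuffle_ins_bas:
  "shuffle (ins k (bas u)) (ins n (bas v)) =
    ins k (shuffle (bas u) (ins n (bas v))) + ins n (shuffle (ins k (bas u)) (bas v))"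
proof (induction "k + n + length u + length v" arbitrary: k n u v rule: less_induct)
  case less
  \<comment> \<open>The right-hand side as a function of vectors, since stripping a word may give
    zero instead of a word.\<close>
  define R where "R = (\<lambda>k f n g. ins k (shuffle f (ins n g)) + ins n (shuffle (ins k f) g))"
  have R: "shuffle (ins k' (bas u')) (ins n' (bas v')) = R k' (bas u') n' (bas v')"
    if "k' + n' + length u' + length v' < k + n + length u + length v" for k' n' u' v'
    unfolding R_def by (rule less[OF that])
  note add = strip_shuffle strip_X0_ins strip_X1_ins strip_add ins_add ins_zero
    lin_add[OF lin_shuffle_left[OF lin_ident]] lin_add[OF lin_shuffle_right[OF lin_ident]] shuffle_zero
  have u: "shuffle (ins k (strip X0 (bas u))) (ins n (bas v)) = R k (strip X0 (bas u)) n (bas v)"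
  proof (cases u)
    case Nil
    then show ?thesis by (simp add: R_def strip_bas add)
  next
    case (Cons b u')
    then show ?thesis using R[of k n u' v] by (simp add: strip_bas R_def add)
  qed
  have v: "shuffle (ins k (bas u)) (ins n (strip X0 (bas v))) = R k (bas u) n (strip X0 (bas v))"
  proof (cases v)
    case Nil
    then show ?thesis by (simp add: R_def strip_bas add)
  next
    case (Cons b v')
    then show ?thesis using R[of k n u v'] by (simp add: strip_bas R_def add)
  qed
  have k: "shuffle (ins (k - 1) (bas u)) (ins n (bas v)) = R (k - 1) (bas u) n (bas v)" if "k \<noteq> 0"
    using that by (intro R) auto
  have n: "shuffle (ins k (bas u)) (ins (n - 1) (bas v)) = R k (bas u) (n - 1) (bas v)" if "n \<noteq> 0"
    using that by (intro R) auto
  show ?case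
  proof (rule eq_by_strip)
    show "strip a (shuffle (ins k (bas u)) (ins n (bas v))) =
        strip a (ins k (shuffle (bas u) (ins n (bas v))) + ins n (shuffle (ins k (bas u)) (bas v)))" for a
    proof (cases a)
      case X1
      then show ?thesis by (simp add: add)
    next
      case X0
      then show ?thesis
        using u v k n
        by (cases "k = 0"; cases "n = 0") (simp_all add: R_def add add_ac)
    qed
    show "Poly_Mapping.lookup (shuffle (ins k (bas u)) (ins n (bas v))) [] =
        Poly_Mapping.lookup (ins k (shuffle (bas u) (ins n (bas v))) + ins n (shuffle (ins k (bas u)) (bas v))) []"
      by (simp add: lookup_shuffle_Nil lookup_ins_Nil lookup_add)
  qed
qed

lemma shuffle_ins:
  "shuffle (ins k u) (ins n v) = ins k (shuffle u (ins n v)) + ins n (shuffle (ins k u) v)"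
proof (rule lin_eq_bas[of "\<lambda>u. shuffle (ins k u) (ins n v)"
      "\<lambda>u. ins k (shuffle u (ins n v)) + ins n (shuffle (ins k u) v)"])
  fix x
  show "shuffle (ins k (bas x)) (ins n v) =
      ins k (shuffle (bas x) (ins n v)) + ins n (shuffle (ins k (bas x)) v)"
    by (rule lin_eq_bas[of "\<lambda>v. shuffle (ins k (bas x)) (ins n v)"
          "\<lambda>v. ins k (shuffle (bas x) (ins n v)) + ins n (shuffle (ins k (bas x)) v)"])
      (auto intro!: lin_shuffle_left lin_shuffle_right lin_ins lin_intros shuffle_ins_bas)
qed (auto intro!: lin_shuffle_left lin_shuffle_right lin_ins lin_intros)

lemma sum_atMost_Suc_shift_zero:
  fixes f :: "nat \<Rightarrow> 'a::comm_monoid_add"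
  assumes "f 0 = 0"
  shows "(\<Sum>i\<le>k. f (Suc i)) = (\<Sum>i\<le>Suc k. f i)"
  by (simp add: sum.atMost_Suc_shift assms del: sum.atMost_Suc)

text \<open>The expansion of \<open>X_1^n/n! (X_1 + X_2)^k/k!\<close> in divided powers. The
  induction follows the recursion of \<open>ins_word\<close>; the coefficients add up by Pascal's
  rule.\<close>

lemma ins_word_replicate:
  "ins_word n (replicate k X0 @ X1 # r) = (\<Sum>i\<le>k. scl (of_nat (n + i choose n))
    (bas (replicate (n + i) X0 @ X1 # replicate (k - i) X0 @ X1 # r)))"
proof (induction "n + k" arbitrary: n k rule: less_induct)
  case less
  note pre = lin_add[OF lin_prepend[OF lin_ident]] lin_sum[OF lin_prepend[OF lin_ident]]
    lin_scl[OF lin_prepend[OF lin_ident]] prepend_bas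
  show ?case
  proof (cases n)
    case n: 0
    show ?thesis
    proof (cases k)
      case 0
      then show ?thesis using n by simp
    next
      case (Suc k')
      then show ?thesis
        using n less[of 0 k'] by (simp add: sum.atMost_Suc_shift pre del: sum.atMost_Suc)
    qed
  next
    case n: (Suc n')
    show ?thesis
    proof (cases k)
      case 0
      then show ?thesis using n less[of n' 0] by (simp add: pre)
    next
      case (Suc k')
      define f where "f i = bas (replicate (n + i) X0 @ X1 # replicate (k - i) X0 @ X1 # r)" for i
      \<comment> \<open>Shifting the index aligns the sums for Pascal's rule; the new term at index
        0 is zero because \<open>n' choose n\<close> vanishes for \<open>n = Suc n'\<close>.\<close>
      have "(\<Sum>i\<le>k'. scl (of_nat (n + i choose n)) (f (Suc i))) =
          (\<Sum>i\<le>k'. scl (of_nat (n' + Suc i choose n)) (f (Suc i)))"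
        by (simp add: n)
      also have "\<dots> = (\<Sum>i\<le>k. scl (of_nat (n' + i choose n)) (f i))"
        unfolding Suc by (rule sum_atMost_Suc_shift_zero) (simp add: n)
      finally have shift: "(\<Sum>i\<le>k'. scl (of_nat (n + i choose n)) (f (Suc i))) =
          (\<Sum>i\<le>k. scl (of_nat (n' + i choose n)) (f i))" .
      have "ins_word n (replicate k X0 @ X1 # r) =
          prepend X0 (ins_word n' (replicate k X0 @ X1 # r)) + prepend X0 (ins_word n (replicate k' X0 @ X1 # r))"
        by (simp add: n Suc pre)
      also have "prepend X0 (ins_word n' (replicate k X0 @ X1 # r)) =
          (\<Sum>i\<le>k. scl (of_nat (n' + i choose n')) (f i))"
        using less[of n' k] by (simp add: n pre f_def)
      also have "prepend X0 (ins_word n (replicate k' X0 @ X1 # r)) =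
          (\<Sum>i\<le>k'. scl (of_nat (n + i choose n)) (f (Suc i)))"
        using less[of n k'] by (simp add: Suc pre f_def)
      also note shift
      also have "(\<Sum>i\<le>k. scl (of_nat (n' + i choose n')) (f i)) +
          (\<Sum>i\<le>k. scl (of_nat (n' + i choose n)) (f i)) = (\<Sum>i\<le>k. scl (of_nat (n + i choose n)) (f i))"
        by (simp add: n sum.distrib[symmetric] fvs.scale_left_distrib[symmetric])
      finally show ?thesis by (simp add: f_def)
    qed
  qed
qed

section \<open>Change of coordinates\<close>

definition pnum :: "nat \<Rightarrow> num" where
  "pnum n = num_of_nat (Suc n)"

lemma nat_of_num_pnum [simp]: "nat_of_num (pnum n) = Suc n"
  unfolding pnum_def by (rule num_of_nat_inverse) simp

lemma pnum_nat_of_num [simp]: "pnum (nat_of_num x - 1) = x"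
  using nat_of_num_pos[of x] by (simp add: num_eq_iff)

lemma inj_pnum: "inj pnum"
  by (rule injI) (metis nat_of_num_pnum nat.inject)

lemma pnum_0: "pnum 0 = num.One" and pnum_Suc: "pnum n + num.One = pnum (Suc n)"
  by (simp_all add: num_eq_iff nat_of_num_add)

lemma numeral_pnum: "numeral (pnum n) = (of_nat (Suc n) :: rat)"
  by (metis nat_of_num_pnum nat_of_num_numeral of_nat_numeral)

text \<open>\<open>mon l\<close> is \<open>\<Prod> X\<^sub>i\<^bsup>l\<^sub>i\<^esup>/l\<^sub>i!\<close>: exponents are one less than the entries of the tuple.\<close>

definition mon :: "nat list \<Rightarrow> H" where
  "mon l = bas (map pnum l)"

lemma bas_eq_mon: "bas s = mon (map (\<lambda>x. nat_of_num x - 1) s)"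
  by (simp add: mon_def comp_def del: One_nat_def)

lemma lin_eq_mon:
  assumes "lin f" "lin g" "\<And>l. f (mon l) = g (mon l)"
  shows "f u = g u"
  by (rule lin_eq_bas[OF assms(1,2)]) (simp add: bas_eq_mon assms(3))

lemma lookup_mon: "Poly_Mapping.lookup (mon l) (map pnum t) = (if l = t then 1 else 0)"
  by (simp add: mon_def bas_def lookup_single when_def inj_map_eq_map[OF inj_pnum])

section \<open>Transport of the shuffle product and of the prepending operators along
  \<open>rho\<close>\<close>

lemma lin_rho: "lin h \<Longrightarrow> lin (\<lambda>u. rho (h u))"
  unfolding rho_def by (rule lin_lin_ext)

lemma rho_bas: "rho (bas s) = bas (rho_word s)"
  by (simp add: rho_def)

text \<open>The range of \<open>rho\<close> is closed under \<open>shuffle\<close>, so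
  \<open>inv rho\<close> is a true inverse here. The identities for \<open>H_shuffle\<close> below
  follow by applying the injective \<open>rho\<close> to both sides.\<close>

lemma rho_H_shuffle: "rho (H_shuffle u v) = shuffle (rho u) (rho v)"
  unfolding H_shuffle_def by (rule f_inv_into_f[OF shuffle_range_rho])

lemma rho_eqD: "rho u = rho v \<Longrightarrow> u = v"
  using inj_rho by (rule injD)

lemma lin_H_shuffle_left: "lin (\<lambda>u. H_shuffle u v)"
  by (rule linI; rule rho_eqD)
    (simp_all add: rho_H_shuffle lin_add[OF lin_rho[OF lin_ident]] lin_scl[OF lin_rho[OF lin_ident]]
      lin_add[OF lin_shuffle_left[OF lin_ident]] lin_scl[OF lin_shuffle_left[OF lin_ident]])

lemma lin_H_shuffle_right: "lin (H_shuffle u)"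
  by (rule linI; rule rho_eqD)
    (simp_all add: rho_H_shuffle lin_add[OF lin_rho[OF lin_ident]] lin_scl[OF lin_rho[OF lin_ident]]
      lin_add[OF lin_shuffle_right[OF lin_ident]] lin_scl[OF lin_shuffle_right[OF lin_ident]])

lemma H_shuffle_one_left: "H_shuffle H_one u = u"
  by (rule rho_eqD) (simp add: rho_H_shuffle H_one_def rho_bas shuffle_one_left)

lemma H_shuffle_one_right: "H_shuffle u H_one = u"
  by (rule rho_eqD) (simp add: rho_H_shuffle H_one_def rho_bas shuffle_one_right)

text \<open>The expansion in \<open>ins_word_replicate\<close> read in exponents. In depth zero
  there is no variable to substitute for, and the result is \<open>X_1^n/n!\<close>.\<close>

fun ins_mon :: "nat \<Rightarrow> nat list \<Rightarrow> H" where
  "ins_mon n [] = mon [n]"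
| "ins_mon n (k # l) = (\<Sum>i\<le>k. scl (of_nat (n + i choose n)) (mon ((n + i) # (k - i) # l)))"

definition H_ins :: "nat \<Rightarrow> H \<Rightarrow> H" where
  "H_ins n = lin_ext (\<lambda>s. ins_mon n (map (\<lambda>x. nat_of_num x - 1) s))"

lemma lin_H_ins: "lin (H_ins n)" and lin_H_ins': "lin h \<Longrightarrow> lin (\<lambda>u. H_ins n (h u))"
  unfolding H_ins_def by (rule linear_lin_ext, rule lin_lin_ext)

lemma H_ins_mon: "H_ins n (mon l) = ins_mon n l"
  by (simp add: H_ins_def mon_def comp_def)

lemma ins_word_Nil: "ins_word n [] = bas (replicate n X0 @ [X1])"
  by (induction n) (simp_all add: prepend_bas)

text \<open>The closed form of \<open>ins_word\<close> on the first block matches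
  \<open>ins_mon\<close>; through this the shuffle recursion pulls back to
  \<open>H_shuffle\<close>.\<close>

lemma rho_H_ins: "rho (H_ins n u) = ins n (rho u)"
proof (rule lin_eq_mon[of "\<lambda>u. rho (H_ins n u)"])
  fix l
  show "rho (H_ins n (mon l)) = ins n (rho (mon l))"
  proof (cases l)
    case Nil
    then show ?thesis
      unfolding H_ins_mon by (simp add: mon_def rho_bas ins_bas ins_word_Nil)
  next
    case (Cons k l')
    then show ?thesis
      unfolding H_ins_mon
      by (simp add: lin_sum[OF lin_rho[OF lin_ident]] lin_scl[OF lin_rho[OF lin_ident]]
          mon_def rho_bas ins_bas ins_word_replicate)
  qed
qed (auto intro!: lin_rho lin_H_ins' lin_ins lin_ident)

lemma H_shuffle_H_ins:
  "H_shuffle (H_ins k u) (H_ins n v) =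
    H_ins k (H_shuffle u (H_ins n v)) + H_ins n (H_shuffle (H_ins k u) v)"
  by (rule rho_eqD)
    (simp add: lin_add[OF lin_rho[OF lin_ident]] rho_H_shuffle rho_H_ins shuffle_ins)

lemma lookup_H_ins_Nil: "Poly_Mapping.lookup (H_ins n u) [] = 0"
  using lookup_rho[of "H_ins n u" "[]"] by (simp add: rho_H_ins lookup_ins_Nil)

section \<open>The operators \<open>delta\<close> and \<open>D_op\<close> as multiplications\<close>

definition raise :: "nat \<Rightarrow> nat list \<Rightarrow> H" where
  "raise j l = scl (of_nat (Suc (l ! j))) (mon (l[j := Suc (l ! j)]))"

lemma incr_pnum: "j < length l \<Longrightarrow> incr (Suc j) (map pnum l) = map pnum (l[j := Suc (l ! j)])"
  by (simp add: incr_def map_update pnum_Suc)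

lemma lin_delta: "lin (delta i)" and lin_delta': "lin h \<Longrightarrow> lin (\<lambda>u. delta i (h u))"
  unfolding delta_def by (rule linear_lin_ext, rule lin_lin_ext)

lemma lin_D_op: "lin (D_op i)"
  unfolding D_op_def[abs_def] by (intro lin_minus lin_delta)

lemma delta_nonpos: "i \<le> 0 \<Longrightarrow> delta i u = 0"
  by (simp add: delta_def lin_ext_def)

lemma delta_mon: "delta (int p) (mon l) = (if p \<le> length l then \<Sum>j<p. raise j l else 0)"
proof (cases "1 \<le> p \<and> p \<le> length l")
  case True
  have "delta (int p) (mon l) =
      (\<Sum>j = 1..p. scl (numeral (map pnum l ! (j - 1))) (bas (incr j (map pnum l))))"
    using True by (simp add: delta_def mon_def)
  also have "\<dots> = (\<Sum>j<p. scl (numeral (map pnum l ! j)) (bas (incr (Suc j) (map pnum l))))"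
    by (simp add: sum.atLeast1_atMost_eq)
  also have "\<dots> = (\<Sum>j<p. raise j l)"
    by (rule sum.cong) (use True in \<open>auto simp: raise_def mon_def incr_pnum numeral_pnum\<close>)
  finally show ?thesis using True by simp
next
  case False
  then have "p = 0 \<or> \<not> p \<le> length l" by auto
  then show ?thesis by (auto simp: delta_def mon_def)
qed

text \<open>The difference of two partial sums leaves the summand at position \<open>j\<close>. On
  divided powers \<open>raise j\<close> is multiplication by \<open>X_(j+1)\<close>, as
  \<open>X * X^n/n! = (n+1) X^(n+1)/(n+1)!\<close>.\<close>

lemma D_op_mon: "j < length l \<Longrightarrow> D_op (int (Suc j)) (mon l) = raise j l"
  using delta_mon[of "Suc j" l] delta_mon[of j l] by (simp add: D_op_def)

text \<open>\<open>delta 1\<close> multiplies by \<open>X_1 = U_1\<close>, and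
  \<open>U * U^n/n! = (n+1) U^(n+1)/(n+1)!\<close>; on coefficients this is the absorption identity
  \<open>binom\<close>.\<close>

lemma delta_1_H_ins: "delta 1 (H_ins n u) = scl (of_nat (Suc n)) (H_ins (Suc n) u)"
proof (rule lin_eq_mon[of "\<lambda>u. delta 1 (H_ins n u)"])
  fix l
  have binom: "of_nat (Suc (n + i)) * of_nat (n + i choose n) =
      (of_nat (Suc n) * of_nat (Suc n + i choose Suc n) :: rat)" for i
    using arg_cong[OF Suc_times_binomial_eq[of "n + i" n], of "of_nat :: nat \<Rightarrow> rat"]
    by (simp only: of_nat_mult mult.commute add_Suc)
  have *: "delta 1 (mon (k # t)) = scl (of_nat (Suc k)) (mon (Suc k # t))" for k t
    using delta_mon[of 1 "k # t"] by (simp add: raise_def)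
  show "delta 1 (H_ins n (mon l)) = scl (of_nat (Suc n)) (H_ins (Suc n) (mon l))"
  proof (cases l)
    case Nil
    then show ?thesis by (simp add: H_ins_mon *)
  next
    case (Cons k l')
    have "delta 1 (H_ins n (mon l)) =
        (\<Sum>i\<le>k. scl (of_nat (n + i choose n) * of_nat (Suc (n + i))) (mon (Suc (n + i) # (k - i) # l')))"
      unfolding Cons H_ins_mon by (simp add: lin_sum[OF lin_delta] lin_scl[OF lin_delta] *)
    also have "\<dots> = scl (of_nat (Suc n)) (H_ins (Suc n) (mon l))"
      unfolding Cons H_ins_mon
      using binom by (simp add: fvs.scale_sum_right mult.commute del: of_nat_Suc)
    finally show ?thesis .
  qed
qed (auto intro!: lin_delta' lin_scale lin_H_ins' lin_ident)

text \<open>Substituting \<open>X_1 + X_2\<close> for \<open>X_1\<close> turns the sum of the first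
  \<open>p + 1\<close> variables into the sum of the first \<open>p + 2\<close>, so the
  multiplication passes through \<open>H_ins n\<close> with its index raised by one.\<close>

lemma delta_Suc_H_ins: "delta (int (Suc (Suc p))) (H_ins n u) = H_ins n (delta (int (Suc p)) u)"
proof (rule lin_eq_mon[of "\<lambda>u. delta (int (Suc (Suc p))) (H_ins n u)"])
  fix l
  show "delta (int (Suc (Suc p))) (H_ins n (mon l)) = H_ins n (delta (int (Suc p)) (mon l))"
  proof (cases l)
    case Nil
    then show ?thesis
      unfolding H_ins_mon delta_mon by (simp add: delta_mon lin_0[OF lin_H_ins] del: of_nat_Suc)
  next
    case (Cons k t)
    define c where "c i = (of_nat (n + i choose n) :: rat)" for i
    define f where "f i = mon ((n + i) # (Suc k - i) # t)" for i
    \<comment> \<open>Raising \<open>X_1\<close> in term \<open>i\<close> lands on the monomial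
      \<open>f (Suc i)\<close>; this rewrites its coefficient in terms of that index.\<close>
    have c: "of_nat (Suc (n + i)) * c i = of_nat (Suc i) * c (Suc i)" for i
      using binomial_absorb_comp[of "Suc (n + i)" n]
      by (simp add: c_def flip: of_nat_mult del: of_nat_Suc)
    have ins: "H_ins n (mon (k # t)) = (\<Sum>i\<le>k. scl (c i) (mon ((n + i) # (k - i) # t)))" for k t
      by (simp add: H_ins_mon c_def)
    show ?thesis
    proof (cases "p \<le> length t")
      \<comment> \<open>The index exceeds the depth on both sides, so both vanish.\<close>
      case False
      then show ?thesis
        unfolding Cons ins by (simp add: lin_sum[OF lin_delta] lin_scl[OF lin_delta] delta_mon
            lin_0[OF lin_H_ins] del: of_nat_Suc)
    next
      case True
      define g where "g j i = raise (Suc (Suc j)) ((n + i) # (k - i) # t)" for i j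
      have raise2: "raise (Suc j) (x # l) =
          scl (of_nat (Suc (l ! j))) (mon (x # l[j := Suc (l ! j)]))" for j x l
        by (simp add: raise_def)
      have "(\<Sum>i\<le>k. scl (of_nat (Suc (n + i)) * c i) (f (Suc i))) =
          (\<Sum>i\<le>k. scl (of_nat (Suc i) * c (Suc i)) (f (Suc i)))"
        by (simp only: c)
      also have "\<dots> = (\<Sum>i\<le>Suc k. scl (of_nat i * c i) (f i))"
        by (rule sum_atMost_Suc_shift_zero) simp
      finally have 1: "(\<Sum>i\<le>k. scl (of_nat (Suc (n + i)) * c i) (f (Suc i))) =
          (\<Sum>i\<le>Suc k. scl (of_nat i * c i) (f i))" .
      \<comment> \<open>Raising the first and the second variable contributes \<open>i\<close> and
        \<open>Suc k - i\<close> to the factor at \<open>f i\<close>. Together they give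
        \<open>Suc k\<close>, the factor from raising the single variable before the
        substitution.\<close>
      have "(\<Sum>i\<le>k. scl (of_nat (Suc (n + i)) * c i) (f (Suc i))) +
          (\<Sum>i\<le>k. scl (of_nat (Suc k - i) * c i) (f i)) =
          (\<Sum>i\<le>Suc k. scl (of_nat i * c i) (f i) + scl (of_nat (Suc k - i) * c i) (f i))"
        unfolding 1 sum.distrib by simp
      also have "\<dots> = (\<Sum>i\<le>Suc k. scl (of_nat (Suc k) * c i) (f i))"
        by (rule sum.cong)
          (auto simp flip: fvs.scale_left_distrib distrib_right of_nat_add simp del: of_nat_Suc)
      also have "\<dots> = H_ins n (raise 0 (k # t))"
        by (simp add: raise_def lin_scl[OF lin_H_ins] ins f_def fvs.scale_sum_right del: of_nat_Suc sum.atMost_Suc)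
      finally have 2: "(\<Sum>i\<le>k. scl (of_nat (Suc (n + i)) * c i) (f (Suc i))) +
          (\<Sum>i\<le>k. scl (of_nat (Suc k - i) * c i) (f i)) = H_ins n (raise 0 (k # t))" .
      have "delta (int (Suc (Suc p))) (H_ins n (mon l)) =
          (\<Sum>i\<le>k. scl (c i) (\<Sum>j<Suc (Suc p). raise j ((n + i) # (k - i) # t)))"
        unfolding Cons ins using True
        by (simp add: lin_sum[OF lin_delta] lin_scl[OF lin_delta] delta_mon del: of_nat_Suc sum.lessThan_Suc)
      also have "\<dots> = (\<Sum>i\<le>k. scl (c i) (raise 0 ((n + i) # (k - i) # t)) +
          scl (c i) (raise 1 ((n + i) # (k - i) # t)) + (\<Sum>j<p. scl (c i) (g j i)))"
        by (simp add: sum.lessThan_Suc_shift fvs.scale_right_distrib fvs.scale_sum_right g_def add.assoc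
            del: sum.lessThan_Suc)
      also have "\<dots> = (\<Sum>i\<le>k. scl (of_nat (Suc (n + i)) * c i) (f (Suc i))) +
          (\<Sum>i\<le>k. scl (of_nat (Suc k - i) * c i) (f i)) + (\<Sum>i\<le>k. \<Sum>j<p. scl (c i) (g j i))"
        unfolding sum.distrib
        by (intro arg_cong2[where f = "(+)"] sum.cong refl)
          (auto simp: raise_def f_def mult.commute Suc_diff_le simp del: of_nat_Suc)
      also have "(\<Sum>i\<le>k. \<Sum>j<p. scl (c i) (g j i)) = (\<Sum>j<p. \<Sum>i\<le>k. scl (c i) (g j i))"
        by (rule sum.swap)
      also have "\<dots> = (\<Sum>j<p. H_ins n (raise (Suc j) (k # t)))"
        by (rule sum.cong)
          (simp_all add: g_def raise2 lin_scl[OF lin_H_ins] ins fvs.scale_sum_right mult.commute del: of_nat_Suc)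
      also have "(\<Sum>i\<le>k. scl (of_nat (Suc (n + i)) * c i) (f (Suc i))) +
          (\<Sum>i\<le>k. scl (of_nat (Suc k - i) * c i) (f i)) + (\<Sum>j<p. H_ins n (raise (Suc j) (k # t))) =
          H_ins n (\<Sum>j<Suc p. raise j (k # t))"
        unfolding 2 by (simp add: sum.lessThan_Suc_shift lin_add[OF lin_H_ins] lin_sum[OF lin_H_ins]
            del: sum.lessThan_Suc)
      finally show ?thesis
        using True by (simp add: Cons delta_mon del: of_nat_Suc sum.lessThan_Suc)
    qed
  qed
qed (auto intro!: lin_delta' lin_H_ins' lin_ident)

text \<open>Mirrors the specification of the coproduct: every tuple arises from
  \<open>[1, ..., 1]\<close> by raising single entries.\<close>

lemma list_raise_induct [case_names zero raise]:
  assumes "\<And>k. P (replicate k 0)"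
    and "\<And>l j. j < length l \<Longrightarrow> P l \<Longrightarrow> P (l[j := Suc (l ! j)])"
  shows "P (l :: nat list)"
proof (induction "sum_list l" arbitrary: l rule: less_induct)
  case less
  show ?case
  proof (cases "\<exists>j<length l. l ! j \<noteq> 0")
    case False
    then have "l = replicate (length l) 0"
      by (simp add: list_eq_iff_nth_eq)
    then show ?thesis using assms(1) by metis
  next
    case True
    then obtain j m where j: "j < length l" "l ! j = Suc m"
      by (metis not0_implies_Suc)
    define l' where "l' = l[j := m]"
    have "sum_list l' < sum_list l"
      using j elem_le_sum_list[of j l] by (simp add: l'_def sum_list_update)
    then have "P l'" by (rule less)
    then have "P (l'[j := Suc (l' ! j)])"
      using j by (intro assms(2)) (simp_all add: l'_def)
    then show ?thesis
      using j list_update_id[of l j] by (simp add: l'_def)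
  qed
qed

text \<open>\<open>ubas w\<close> is \<open>\<Prod> U\<^sub>i\<^bsup>w\<^sub>i\<^esup>/w\<^sub>i!\<close>.\<close>

fun ubas :: "nat list \<Rightarrow> H" where
  "ubas [] = H_one"
| "ubas (n # w) = H_ins n (ubas w)"

text \<open>\<open>delta_Suc_H_ins\<close> moves the operator past one letter at a time until it
  reaches position \<open>j\<close> as \<open>delta 1\<close>. So \<open>delta\<close> multiplies by
  a single coordinate \<open>U_(j+1)\<close>.\<close>

lemma delta_ubas:
  "delta (int (Suc j)) (ubas w) =
    (if j < length w then scl (of_nat (Suc (w ! j))) (ubas (w[j := Suc (w ! j)])) else 0)"
proof (induction w arbitrary: j)
  case Nil
  then show ?case
    using delta_mon[of "Suc j" "[]"] by (simp add: H_one_def mon_def)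
next
  case (Cons n w)
  show ?case
  proof (cases j)
    case 0
    then show ?thesis using delta_1_H_ins[of n "ubas w"] by simp
  next
    case (Suc i)
    show ?thesis
      unfolding Suc ubas.simps delta_Suc_H_ins Cons
      by (simp add: lin_scl[OF lin_H_ins] lin_0[OF lin_H_ins])
  qed
qed

text \<open>Word length equals depth; this fixes the shift when \<open>shifted_tensor\<close> acts
  on a deconcatenation.\<close>

lemma ubas_dep: "ubas w \<in> fvs.span {bas s | s. dep s = length w}"
proof (induction w)
  case Nil
  then show ?case by (auto intro!: fvs.span_base simp: H_one_def)
next
  case (Cons n w)
  have mon: "mon l \<in> fvs.span {bas s | s. dep s = k}" if "length l = k" for l k
    using that by (auto intro!: fvs.span_base exI[of _ "map pnum l"] simp: mon_def)
  have "ins_mon n l \<in> fvs.span {bas s | s. dep s = length (n # w)}" if "length l = length w" for l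
    using that by (cases l) (auto intro!: mon fvs.span_sum fvs.span_scale)
  then have "H_ins n (bas s) \<in> fvs.span {bas s | s. dep s = length (n # w)}" if "dep s = length w" for s
    unfolding bas_eq_mon[of s] H_ins_mon using that by simp
  then show ?case
    unfolding ubas.simps by (intro lin_mem_span[OF lin_H_ins Cons fvs.subspace_span]) auto
qed

text \<open>Both are the constant 1 in depth \<open>k\<close>, so the two bases share the starting
  point of the recursion.\<close>

lemma ubas_replicate_0: "ubas (replicate k 0) = mon (replicate k 0)"
proof (induction k)
  case 0
  then show ?case by (simp add: H_one_def mon_def)
next
  case (Suc k)
  then have "ubas (replicate (Suc k) 0) = ins_mon 0 (replicate k 0)"
    by (simp add: H_ins_mon)
  then show ?case by (cases k) simp_all
qed

text \<open>The span of the words of one length contains the constant 1 and is stable under each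
  \<open>delta i\<close>, hence under multiplication by each variable; this reaches every monomial
  of that depth.\<close>

lemma mon_in_span_ubas: "mon l \<in> fvs.span (ubas ` {w. length w = length l})"
proof (induction l rule: list_raise_induct)
  case (zero k)
  have "mon (replicate k 0) = ubas (replicate k 0)" by (simp add: ubas_replicate_0)
  then show ?case by (auto intro!: fvs.span_base)
next
  case (raise l j)
  let ?V = "fvs.span (ubas ` {w. length w = length l})"
  have delta: "delta i u \<in> ?V" if "u \<in> ?V" for i u
  proof (cases "i \<le> 0")
    case True
    then show ?thesis by (simp add: delta_nonpos fvs.span_zero)
  next
    case False
    then obtain p where "i = int (Suc p)"
      by (metis not_le pos_int_cases gr0_implies_Suc)
    moreover have "delta (int (Suc p)) (ubas w) \<in> ?V" if "length w = length l" for w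
      unfolding delta_ubas using that
      by (cases "p < length w")
        (simp_all add: fvs.span_zero, intro fvs.span_scale fvs.span_base, simp)
    ultimately show ?thesis
      using that by (elim lin_mem_span[OF lin_delta _ fvs.subspace_span]) auto
  qed
  have "raise j l \<in> ?V"
    unfolding D_op_mon[OF raise(1), symmetric] D_op_def
    by (intro fvs.span_diff delta raise)
  then have "scl (1 / of_nat (Suc (l ! j))) (raise j l) \<in> ?V"
    by (rule fvs.span_scale)
  then show ?case by (simp add: raise_def del: of_nat_Suc)
qed

section \<open>Bijectivity of the change of basis\<close>

lemma surj_ubas: "surj (lin_ext ubas)"
proof -
  have "u \<in> range (lin_ext ubas)" for u
  proof -
    have "u \<in> fvs.span (range bas)" by (simp add: span_bas)
    then have "id u \<in> fvs.span (range ubas)"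
    proof (rule lin_mem_span[OF lin_id _ fvs.subspace_span])
      fix a assume "a \<in> range (bas :: num list \<Rightarrow> H)"
      then obtain l where "a = mon l" by (auto simp: bas_eq_mon)
      then show "id a \<in> fvs.span (range ubas)"
        using mon_in_span_ubas[of l] fvs.span_mono[of "ubas ` {w. length w = length l}" "range ubas"]
        by auto
    qed
    then have "u \<in> fvs.span (range ubas)" by simp
    then show ?thesis
    proof (induction rule: fvs.span_induct_alt)
      case base
      then show ?case by (metis lin_0[OF linear_lin_ext] rangeI)
    next
      case (step c x y)
      then obtain w z where "x = ubas w" "y = lin_ext ubas z" by auto
      then have "scl c x + y = lin_ext ubas (scl c (bas w) + z)"
        by (simp add: lin_add[OF linear_lin_ext] lin_scl[OF linear_lin_ext])
      then show ?case by blast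
    qed
  qed
  then show ?thesis by auto
qed

text \<open>For nonempty \<open>l\<close> the summand \<open>i = 0\<close> is the monomial
  \<open>n # l\<close> with coefficient 1, and all others have a larger first exponent.\<close>

lemma lookup_ins_mon:
  "Poly_Mapping.lookup (ins_mon n l) (map pnum t) \<noteq> 0 \<Longrightarrow> n # l \<le> t"
  "Poly_Mapping.lookup (ins_mon n l) (map pnum (n # l)) = 1"
proof -
  show "n # l \<le> t" if nz: "Poly_Mapping.lookup (ins_mon n l) (map pnum t) \<noteq> 0"
  proof (cases l)
    case Nil
    then show ?thesis using nz by (simp add: lookup_mon split: if_splits)
  next
    case (Cons k r)
    obtain i where "i \<le> k" "Poly_Mapping.lookup (mon ((n + i) # (k - i) # r)) (map pnum t) \<noteq> 0"
      using nz unfolding Cons ins_mon.simps lookup_sum lookup_scl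
      by (metis (no_types, lifting) atMost_iff mult_zero_right sum.neutral)
    then have "i \<le> k" "t = (n + i) # (k - i) # r"
      by (simp_all add: lookup_mon split: if_splits)
    then show ?thesis using Cons by (cases "i = 0") auto
  qed
  show "Poly_Mapping.lookup (ins_mon n l) (map pnum (n # l)) = 1"
  proof (cases l)
    case Nil
    then show ?thesis using lookup_mon[of "[n]" "[n]"] by simp
  next
    case (Cons k r)
    have "Poly_Mapping.lookup (ins_mon n l) (map pnum (n # l)) = (\<Sum>i\<le>k. if i = 0 then 1 else 0)"
      unfolding Cons ins_mon.simps lookup_sum lookup_scl lookup_mon
      by (intro sum.cong) auto
    then show ?thesis by simp
  qed
qed

text \<open>The change of basis is unitriangular for the lexicographic order, hence injective.\<close>

lemma lookup_ubas:
  "(Poly_Mapping.lookup (ubas w) (map pnum t) \<noteq> 0 \<longrightarrow> w \<le> t) \<and>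
    Poly_Mapping.lookup (ubas w) (map pnum w) = 1"
proof (induction w arbitrary: t)
  case Nil
  then show ?case by (simp add: H_one_def bas_def)
next
  case (Cons n w)
  let ?d = "map (\<lambda>x. nat_of_num x - 1)"
  have pd: "map pnum (?d s) = s" for s by (simp add: comp_def del: One_nat_def)
  have dp: "?d (map pnum l) = l" for l by (simp add: comp_def)
  have sum: "Poly_Mapping.lookup (ubas (n # w)) (map pnum t) =
      (\<Sum>s\<in>Poly_Mapping.keys (ubas w). Poly_Mapping.lookup (ubas w) s *
        Poly_Mapping.lookup (ins_mon n (?d s)) (map pnum t))" for t
    by (simp add: H_ins_def lin_ext_def lookup_sum)
  have le: "w \<le> ?d s" if "s \<in> Poly_Mapping.keys (ubas w)" for s
    using Cons[of "?d s"] that unfolding pd in_keys_iff by blast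
  have A: "n # w \<le> t" if nz: "Poly_Mapping.lookup (ubas (n # w)) (map pnum t) \<noteq> 0"
  proof -
    obtain s where s: "s \<in> Poly_Mapping.keys (ubas w)"
      "Poly_Mapping.lookup (ins_mon n (?d s)) (map pnum t) \<noteq> 0"
      using nz unfolding sum by (metis (no_types, lifting) mult_zero_right sum.neutral)
    have "n # w \<le> n # ?d s" using le[OF s(1)] by simp
    also have "\<dots> \<le> t" using lookup_ins_mon(1)[OF s(2)] .
    finally show ?thesis .
  qed
  have B: "Poly_Mapping.lookup (ubas (n # w)) (map pnum (n # w)) = 1"
  proof -
    have "Poly_Mapping.lookup (ubas w) s * Poly_Mapping.lookup (ins_mon n (?d s)) (map pnum (n # w)) =
        (if s = map pnum w then 1 else 0)" if s: "s \<in> Poly_Mapping.keys (ubas w)" for s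
    proof (cases "s = map pnum w")
      case True
      have "?d s = w" using True dp by simp
      then show ?thesis using Cons lookup_ins_mon(2)[of n w] True by (simp only: if_True) simp
    next
      case False
      then have "w < ?d s" using le[OF s] pd[of s] by (metis order_le_less)
      then have "\<not> n # ?d s \<le> n # w" by simp
      then show ?thesis using False lookup_ins_mon(1)[of n "?d s" "n # w"] by auto
    qed
    then have "Poly_Mapping.lookup (ubas (n # w)) (map pnum (n # w)) =
        (\<Sum>s\<in>Poly_Mapping.keys (ubas w). if s = map pnum w then 1 else 0)"
      unfolding sum by (rule sum.cong[OF refl])
    moreover have "map pnum w \<in> Poly_Mapping.keys (ubas w)"
      using Cons by (simp add: in_keys_iff)
    ultimately show ?thesis by simp
  qed
  show ?case by (intro conjI impI A B)
qed

lemma inj_ubas: "inj (lin_ext ubas)"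
proof -
  have zero: "u = 0" if u: "lin_ext ubas u = 0" for u
  proof (rule ccontr)
    assume "u \<noteq> 0"
    \<comment> \<open>The least word of the support: by triangularity the larger words do not
      contribute at \<open>w\<close>, so the coefficient of \<open>u\<close> at \<open>w\<close>
      survives in the image.\<close>
    define w where "w = Min (Poly_Mapping.keys u)"
    have w: "w \<in> Poly_Mapping.keys u"
      unfolding w_def using \<open>u \<noteq> 0\<close> by (intro Min_in) auto
    have "Poly_Mapping.lookup (ubas v) (map pnum w) = 0" if "v \<in> Poly_Mapping.keys u" "v \<noteq> w" for v
    proof -
      have "w \<le> v" unfolding w_def by (rule Min_le) (simp_all add: that)
      then show ?thesis using lookup_ubas[of v w] that(2) by auto
    qed
    then have "Poly_Mapping.lookup (lin_ext ubas u) (map pnum w) =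
        (\<Sum>v\<in>Poly_Mapping.keys u. if v = w then Poly_Mapping.lookup u w else 0)"
      unfolding lin_ext_def lookup_sum
      by (intro sum.cong) (auto simp: lookup_ubas)
    then show False using w u by (simp add: in_keys_iff)
  qed
  show ?thesis
  proof (rule injI)
    fix u v assume "lin_ext ubas u = lin_ext ubas v"
    then show "u = v" using zero[of "u - v"] by (simp add: lin_diff[OF linear_lin_ext])
  qed
qed

lemma bij_ubas: "bij (lin_ext ubas)"
  using inj_ubas surj_ubas by (simp add: bij_def)

section \<open>The coproduct\<close>

definition H_cop :: "H \<Rightarrow> HH" where
  "H_cop u = lin_ext (\<lambda>w. \<Sum>j\<le>length w. ubas (take j w) \<otimes>\<^sub>\<rat> ubas (drop j w)) (inv (lin_ext ubas) u)"

lemma lin_H_cop: "lin H_cop"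
  unfolding H_cop_def[abs_def] by (intro lin_lin_ext lin_inv_lin_ext bij_ubas)

lemma H_cop_ubas: "H_cop (ubas w) = (\<Sum>j\<le>length w. ubas (take j w) \<otimes>\<^sub>\<rat> ubas (drop j w))"
proof -
  have "inv (lin_ext ubas) (lin_ext ubas (bas w)) = bas w"
    by (rule inv_f_f[OF inj_ubas])
  then show ?thesis by (simp add: H_cop_def)
qed

lemma lin_eq_ubas:
  assumes "lin f" "lin g" "\<And>w. f (ubas w) = g (ubas w)"
  shows "f u = g u"
proof -
  obtain x where "u = lin_ext ubas x" using surj_ubas by blast
  moreover have "f (lin_ext ubas x) = g (lin_ext ubas x)"
    by (rule lin_eq_bas[of "\<lambda>x. f (lin_ext ubas x)" "\<lambda>x. g (lin_ext ubas x)"])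
      (auto intro!: lin_compose[OF assms(1)] lin_compose[OF assms(2)] linear_lin_ext simp: assms(3))
  ultimately show ?thesis by simp
qed

lemma H_cop_H_ins: "H_cop (H_ins n u) = H_one \<otimes>\<^sub>\<rat> H_ins n u + tensor_map (H_ins n) id (H_cop u)"
proof (rule lin_eq_ubas[of "\<lambda>u. H_cop (H_ins n u)"
      "\<lambda>u. H_one \<otimes>\<^sub>\<rat> H_ins n u + tensor_map (H_ins n) id (H_cop u)"])
  fix w
  have "H_cop (H_ins n (ubas w)) = H_cop (ubas (n # w))" by simp
  also have "\<dots> = H_one \<otimes>\<^sub>\<rat> H_ins n (ubas w) +
      (\<Sum>j\<le>length w. H_ins n (ubas (take j w)) \<otimes>\<^sub>\<rat> ubas (drop j w))"
    unfolding H_cop_ubas by (simp add: sum.atMost_Suc_shift del: sum.atMost_Suc)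
  also have "(\<Sum>j\<le>length w. H_ins n (ubas (take j w)) \<otimes>\<^sub>\<rat> ubas (drop j w)) =
      tensor_map (H_ins n) id (H_cop (ubas w))"
    by (simp add: H_cop_ubas lin_sum[OF lin_tensor_map[OF lin_ident]] tensor_map_tensor lin_H_ins lin_id lin_ident)
  finally show "H_cop (H_ins n (ubas w)) =
      H_one \<otimes>\<^sub>\<rat> H_ins n (ubas w) + tensor_map (H_ins n) id (H_cop (ubas w))" .
qed (auto intro!: lin_intros lin_H_ins' lin_H_cop lin_compose[OF lin_H_cop])

lemma H_cop_one: "H_cop H_one = H_one \<otimes>\<^sub>\<rat> H_one"
  using H_cop_ubas[of "[]"] by simp

text \<open>Multiplication by \<open>U_i\<close> raises one letter, which lies in exactly one factor
  of each splitting. On the other factor \<open>delta\<close> vanishes, its index being nonpositive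
  or larger than the depth.\<close>

lemma H_cop_delta:
  assumes "0 \<le> i" "i \<le> int (length w)"
  shows "H_cop (delta i (ubas w)) = (\<Sum>j\<le>length w. delta i (ubas (take j w)) \<otimes>\<^sub>\<rat> ubas (drop j w) +
    ubas (take j w) \<otimes>\<^sub>\<rat> delta (i - int j) (ubas (drop j w)))"
proof (cases "i = 0")
  case True
  then show ?thesis
    by (simp add: delta_nonpos lin_0[OF lin_H_cop] lin_0[OF lin_tensor_left[OF lin_ident]]
        lin_0[OF lin_tensor_right[OF lin_ident]])
next
  case False
  then obtain p where i: "i = int (Suc p)"
    using assms(1) by (metis nonneg_int_cases not0_implies_Suc of_nat_0)
  then have p: "p < length w" using assms(2) by simp
  define c where "c = (of_nat (Suc (w ! p)) :: rat)"
  define w' where "w' = w[p := Suc (w ! p)]"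
  have "H_cop (delta i (ubas w)) = (\<Sum>j\<le>length w. scl c (ubas (take j w') \<otimes>\<^sub>\<rat> ubas (drop j w')))"
    unfolding i delta_ubas using p
    by (simp add: lin_scl[OF lin_H_cop] H_cop_ubas fvs.scale_sum_right c_def w'_def del: of_nat_Suc)
  also have "\<dots> = (\<Sum>j\<le>length w. delta i (ubas (take j w)) \<otimes>\<^sub>\<rat> ubas (drop j w) +
    ubas (take j w) \<otimes>\<^sub>\<rat> delta (i - int j) (ubas (drop j w)))"
  proof (rule sum.cong[OF refl])
    fix j assume "j \<in> {..length w}"
    then have j: "j \<le> length w" by simp
    show "scl c (ubas (take j w') \<otimes>\<^sub>\<rat> ubas (drop j w')) =
        delta i (ubas (take j w)) \<otimes>\<^sub>\<rat> ubas (drop j w) + ubas (take j w) \<otimes>\<^sub>\<rat> delta (i - int j) (ubas (drop j w))"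
    proof (cases "p < j")
      case True
      have "delta (i - int j) (ubas (drop j w)) = 0"
        using True i by (intro delta_nonpos) simp
      moreover have "delta i (ubas (take j w)) = scl c (ubas (take j w'))"
        unfolding i delta_ubas using True p j
        by (simp add: c_def w'_def take_update_swap del: of_nat_Suc)
      ultimately show ?thesis
        using True by (simp add: w'_def drop_update_cancel lin_scl[OF lin_tensor_left[OF lin_ident]]
            lin_0[OF lin_tensor_right[OF lin_ident]])
    next
      case False
      have "delta i (ubas (take j w)) = 0"
        unfolding i delta_ubas using False by simp
      \<comment> \<open>The raised letter is now at position \<open>p - j\<close> of the right
        factor, which accounts for the shift of the index.\<close>
      moreover have "i - int j = int (Suc (p - j))"
        using False i by simp
      then have "delta (i - int j) (ubas (drop j w)) = scl c (ubas (drop j w'))"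
        using False p j diff_less_mono[of p "length w" j]
        by (simp add: delta_ubas c_def w'_def drop_update_swap del: of_nat_Suc)
      ultimately show ?thesis
        using False by (simp add: w'_def take_update_cancel lin_scl[OF lin_tensor_right[OF lin_ident]]
            lin_0[OF lin_tensor_left[OF lin_ident]])
    qed
  qed
  finally show ?thesis .
qed

section \<open>The recursion satisfied by the coproduct, and its uniqueness\<close>

lemma lin_shifted_tensor: "lin (shifted_tensor A i)"
  unfolding shifted_tensor_def by (rule linear_lin_ext)

text \<open>The shift is read off from the depth of basis elements, so it is uniform on left factors
  of a fixed depth.\<close>

lemma shifted_tensor_tensor:
  assumes "u \<in> fvs.span {bas s | s. dep s = a}"
  shows "shifted_tensor id i (u \<otimes>\<^sub>\<rat> v) = u \<otimes>\<^sub>\<rat> D_op (i - int a) v"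
proof (rule lin_eq_span[OF _ _ assms, of "\<lambda>u. shifted_tensor id i (u \<otimes>\<^sub>\<rat> v)" "\<lambda>u. u \<otimes>\<^sub>\<rat> D_op (i - int a) v"])
  fix x :: H assume "x \<in> {bas s | s. dep s = a}"
  then obtain s where s: "x = bas s" "dep s = a" by auto
  show "shifted_tensor id i (x \<otimes>\<^sub>\<rat> v) = x \<otimes>\<^sub>\<rat> D_op (i - int a) v"
    unfolding s(1)
    by (rule lin_eq_bas[of "\<lambda>v. shifted_tensor id i (bas s \<otimes>\<^sub>\<rat> v)" "\<lambda>v. bas s \<otimes>\<^sub>\<rat> D_op (i - int a) v"])
      (auto intro!: lin_compose[OF lin_shifted_tensor] lin_intros lin_D_op
        simp: tensor_bas shifted_tensor_def s(2))
qed (auto intro!: lin_compose[OF lin_shifted_tensor] lin_intros)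

text \<open>The difference of \<open>H_cop_delta\<close> at \<open>i\<close> and at
  \<open>i - 1\<close>; the bounds keep both indices in its range.\<close>

lemma H_cop_D_op_ubas:
  assumes "1 \<le> i" "i \<le> int (length w)"
  shows "H_cop (D_op i (ubas w)) =
    shifted_tensor id i (H_cop (ubas w)) + tensor_map (D_op i) id (H_cop (ubas w))"
proof -
  let ?a = "\<lambda>j. ubas (take j w)" and ?b = "\<lambda>j. ubas (drop j w)"
  have "shifted_tensor id i (?a j \<otimes>\<^sub>\<rat> ?b j) = ?a j \<otimes>\<^sub>\<rat> D_op (i - int j) (?b j)" if "j \<le> length w" for j
    using ubas_dep[of "take j w"] that by (intro shifted_tensor_tensor) simp
  then have "shifted_tensor id i (H_cop (ubas w)) + tensor_map (D_op i) id (H_cop (ubas w)) =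
      (\<Sum>j\<le>length w. ?a j \<otimes>\<^sub>\<rat> D_op (i - int j) (?b j) + D_op i (?a j) \<otimes>\<^sub>\<rat> ?b j)"
    by (simp add: H_cop_ubas lin_sum[OF lin_shifted_tensor] lin_sum[OF lin_tensor_map[OF lin_ident]]
        tensor_map_tensor lin_D_op lin_id lin_ident sum.distrib)
  also have "\<dots> = H_cop (delta i (ubas w)) - H_cop (delta (i - 1) (ubas w))"
    using assms
    by (simp add: H_cop_delta sum_subtractf[symmetric] D_op_def lin_diff[OF lin_tensor_left[OF lin_ident]]
        lin_diff[OF lin_tensor_right[OF lin_ident]] algebra_simps)
  finally show ?thesis by (simp add: D_op_def lin_diff[OF lin_H_cop])
qed

lemma lin_rec_step: "lin (\<lambda>x. shifted_tensor id i x + tensor_map (D_op i) id x)"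
  by (intro lin_plus lin_shifted_tensor lin_tensor_map lin_ident)

text \<open>Extends linearly from words of the same length as \<open>l\<close>, for which the bound
  on \<open>i\<close> is unchanged.\<close>

lemma H_cop_D_op:
  assumes "1 \<le> i" "i \<le> int (length l)"
  shows "H_cop (D_op i (mon l)) =
    shifted_tensor id i (H_cop (mon l)) + tensor_map (D_op i) id (H_cop (mon l))"
  by (rule lin_eq_span[OF lin_compose[OF lin_H_cop lin_D_op] lin_compose[OF lin_rec_step lin_H_cop]
        mon_in_span_ubas])
    (use assms H_cop_D_op_ubas in auto)

lemma all_nat_split: "(\<forall>k. P k) \<longleftrightarrow> P 0 \<and> (\<forall>k\<ge>1. P (k :: nat))"
  by (metis One_nat_def Suc_leI neq0_conv)

text \<open>Restates the specification in exponents: the value at the unit becomes the case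
  \<open>k = 0\<close>, and clearing the denominator turns the recursion into a rule for
  \<open>raise\<close>.\<close>

lemma is_rec_coproduct_iff:
  "is_rec_coproduct \<Delta> \<longleftrightarrow> lin \<Delta> \<and>
    (\<forall>k. \<Delta> (mon (replicate k 0)) = (\<Sum>j\<le>k. mon (replicate j 0) \<otimes>\<^sub>\<rat> mon (replicate (k - j) 0))) \<and>
    (\<forall>l. \<forall>j<length l. \<Delta> (raise j l) = shifted_tensor id (int (Suc j)) (\<Delta> (mon l)) +
      tensor_map (D_op (int (Suc j))) id (\<Delta> (mon l)))"
proof -
  let ?Q = "\<lambda>i x. shifted_tensor id (int i) x + tensor_map (D_op (int i)) id x"
  have 1: "(\<Delta> H_one = H_one \<otimes>\<^sub>\<rat> H_one \<and> (\<forall>k\<ge>1. \<Delta> (bas (replicate k num.One)) =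
        (\<Sum>j = 0..k. bas (replicate j num.One) \<otimes>\<^sub>\<rat> bas (replicate (k - j) num.One)))) \<longleftrightarrow>
    (\<forall>k. \<Delta> (mon (replicate k 0)) = (\<Sum>j\<le>k. mon (replicate j 0) \<otimes>\<^sub>\<rat> mon (replicate (k - j) 0)))"
    (is "?one \<and> (\<forall>k\<ge>1. ?L k) \<longleftrightarrow> (\<forall>k. ?R k)")
  proof -
    have "?R k \<longleftrightarrow> ?L k" for k
      by (simp add: mon_def pnum_0 atMost_atLeast0)
    then have "(\<forall>k. ?R k) \<longleftrightarrow> (\<forall>k. ?L k)"
      by (simp only:)
    also have "\<dots> \<longleftrightarrow> ?L 0 \<and> (\<forall>k\<ge>1. ?L k)"
      by (rule all_nat_split)
    also have "?L 0 \<longleftrightarrow> ?one"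
      by (simp add: H_one_def)
    finally show ?thesis ..
  qed
  have 2: "\<Delta> (bas (incr (Suc j) (map pnum l))) = scl (1 / numeral (map pnum l ! j)) (?Q (Suc j) (\<Delta> (mon l)))
      \<longleftrightarrow> \<Delta> (raise j l) = ?Q (Suc j) (\<Delta> (mon l))" if "lin \<Delta>" "j < length l" for j l
  proof -
    define c where "c = (of_nat (Suc (l ! j)) :: rat)"
    define x where "x = \<Delta> (mon (l[j := Suc (l ! j)]))"
    define y where "y = ?Q (Suc j) (\<Delta> (mon l))"
    have "\<Delta> (bas (incr (Suc j) (map pnum l))) = x" "numeral (map pnum l ! j) = c" "\<Delta> (raise j l) = scl c x"
      using that by (simp_all add: incr_pnum mon_def x_def c_def numeral_pnum raise_def lin_scl del: of_nat_Suc)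
    moreover have "c \<noteq> 0" by (simp add: c_def del: of_nat_Suc)
    ultimately show ?thesis
      unfolding y_def[symmetric] by auto
  qed
  have 3: "(\<forall>s i. 1 \<le> i \<and> i \<le> dep s \<longrightarrow> P s i) \<longleftrightarrow> (\<forall>l. \<forall>j<length l. P (map pnum l) (Suc j))" for P
  proof (intro iffI allI impI)
    fix s i assume *: "\<forall>l. \<forall>j<length l. P (map pnum l) (Suc j)" "1 \<le> i \<and> i \<le> dep s"
    then obtain j where j: "i = Suc j" by (metis Suc_le_D One_nat_def)
    have "map pnum (map (\<lambda>x. nat_of_num x - 1) s) = s" by (simp add: comp_def del: One_nat_def)
    then show "P s i"
      using *(1)[rule_format, of j "map (\<lambda>x. nat_of_num x - 1) s"] *(2) j by simp
  qed auto
  show ?thesis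
    unfolding is_rec_coproduct_def 1[symmetric] 3 using 2 by (auto simp: mon_def)
qed

lemma is_rec_coproduct_H_cop: "is_rec_coproduct H_cop"
  unfolding is_rec_coproduct_iff
proof (intro conjI allI impI)
  show "lin H_cop" by (rule lin_H_cop)
  show "H_cop (mon (replicate k 0)) = (\<Sum>j\<le>k. mon (replicate j 0) \<otimes>\<^sub>\<rat> mon (replicate (k - j) 0))" for k
    unfolding ubas_replicate_0[symmetric] H_cop_ubas by (auto intro!: sum.cong simp: min_def)
  show "H_cop (raise j l) = shifted_tensor id (int (Suc j)) (H_cop (mon l)) +
      tensor_map (D_op (int (Suc j))) id (H_cop (mon l))" if "j < length l" for j l
    unfolding D_op_mon[OF that, symmetric] using that by (intro H_cop_D_op) auto
qed

lemma is_rec_coproduct_mon_Suc: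
  assumes "is_rec_coproduct \<Delta>" "j < length l"
  shows "\<Delta> (mon (l[j := Suc (l ! j)])) = scl (1 / of_nat (Suc (l ! j)))
    (shifted_tensor id (int (Suc j)) (\<Delta> (mon l)) + tensor_map (D_op (int (Suc j))) id (\<Delta> (mon l)))"
proof -
  have "\<Delta> (raise j l) = scl (of_nat (Suc (l ! j))) (\<Delta> (mon (l[j := Suc (l ! j)])))"
    using assms by (simp add: is_rec_coproduct_iff raise_def lin_scl del: of_nat_Suc)
  moreover have "\<Delta> (raise j l) = shifted_tensor id (int (Suc j)) (\<Delta> (mon l)) + tensor_map (D_op (int (Suc j))) id (\<Delta> (mon l))"
    using assms unfolding is_rec_coproduct_iff by blast
  ultimately show ?thesis
    by (metis fvs.scale_one fvs.scale_scale nonzero_divide_eq_eq of_nat_neq_0)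
qed

lemma is_rec_coproduct_unique:
  assumes "is_rec_coproduct \<Delta>" "is_rec_coproduct \<Delta>'"
  shows "\<Delta> = \<Delta>'"
proof
  fix u
  have "\<Delta> (mon l) = \<Delta>' (mon l)" for l
  proof (induction l rule: list_raise_induct)
    case (zero k)
    then show ?case using assms by (simp add: is_rec_coproduct_iff)
  next
    case (raise l j)
    then show ?case using assms by (simp add: is_rec_coproduct_mon_Suc)
  qed
  moreover have "lin \<Delta>" "lin \<Delta>'"
    using assms by (simp_all add: is_rec_coproduct_def)
  ultimately show "\<Delta> u = \<Delta>' u"
    by (rule lin_eq_mon[rotated 2])
qed

section \<open>The counit and the resulting Hopf algebra\<close>

lemma lin_H_counit: "Vector_Spaces.linear scl (*) H_counit"
  using fvs.vector_space_axioms
  by (auto simp: Vector_Spaces.linear_iff H_counit_def lookup_add vector_space_def algebra_simps)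

lemma H_counit_one: "H_counit H_one = 1"
  by (simp add: H_counit_def H_one_def bas_def)

lemma H_counit_H_ins: "H_counit (H_ins n u) = 0"
  by (simp add: H_counit_def lookup_H_ins_Nil)

interpretation H: shuffle_bialgebra H_shuffle H_one H_ins H_cop H_counit ubas
  by (rule shuffle_bialgebra.intro)
    (rule lin_H_shuffle_left lin_H_shuffle_right H_shuffle_one_left H_shuffle_one_right lin_H_ins
      H_shuffle_H_ins ubas.simps bij_ubas lin_H_cop H_cop_one H_cop_H_ins lin_H_counit H_counit_one
      H_counit_H_ins)+

section \<open>The weight grading\<close>

lemma weight_eq_0: "weight s = 0 \<longleftrightarrow> s = []"
  by (cases s) (simp_all add: weight_def nat_of_num_pos[THEN less_imp_neq, symmetric])

lemma mem_H_weight: "u \<in> H_weight n \<longleftrightarrow> (\<forall>s\<in>Poly_Mapping.keys u. weight s = n)"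
  unfolding H_weight_def by (rule mem_span_bas)

lemma grading_H_weight: "grading H_weight"
  unfolding grading_def
proof (intro conjI allI)
  show "fvs.subspace (H_weight n)" for n
    unfolding H_weight_def by (rule fvs.subspace_span)
  fix u :: H
  show "\<exists>!f. (\<forall>n. Poly_Mapping.lookup f n \<in> H_weight n) \<and>
      u = (\<Sum>n\<in>Poly_Mapping.keys f. Poly_Mapping.lookup f n)"
  proof (rule ex_ex1I)
    \<comment> \<open>The homogeneous components are obtained by sorting the basis terms of
      \<open>u\<close> by weight.\<close>
    define f where "f = (\<Sum>s\<in>Poly_Mapping.keys u.
      Poly_Mapping.single (weight s) (scl (Poly_Mapping.lookup u s) (bas s)))"
    have lookup_f: "Poly_Mapping.lookup f n =
        (\<Sum>s\<in>Poly_Mapping.keys u. if weight s = n then scl (Poly_Mapping.lookup u s) (bas s) else 0)" for n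
      by (simp add: f_def lookup_sum lookup_single when_def)
    let ?N = "weight ` Poly_Mapping.keys u"
    have keys: "Poly_Mapping.keys f \<subseteq> ?N"
    proof
      fix n assume "n \<in> Poly_Mapping.keys f"
      then show "n \<in> ?N"
        by (rule contrapos_pp) (auto simp: in_keys_iff lookup_f intro!: sum.neutral)
    qed
    have "(\<Sum>n\<in>Poly_Mapping.keys f. Poly_Mapping.lookup f n) = (\<Sum>n\<in>?N. Poly_Mapping.lookup f n)"
      using keys by (intro sum.mono_neutral_left) (auto simp: in_keys_iff)
    also have "\<dots> = (\<Sum>s\<in>Poly_Mapping.keys u. \<Sum>n\<in>?N. if weight s = n then scl (Poly_Mapping.lookup u s) (bas s) else 0)"
      unfolding lookup_f by (rule sum.swap)
    also have "\<dots> = lin_ext bas u"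
      unfolding lin_ext_def by (rule sum.cong) (auto simp: sum.delta')
    also have "\<dots> = u"
      by (rule lin_eq_bas[of "lin_ext bas"]) (auto intro!: linear_lin_ext lin_ident)
    finally have "u = (\<Sum>n\<in>Poly_Mapping.keys f. Poly_Mapping.lookup f n)" by simp
    moreover have "Poly_Mapping.lookup f n \<in> H_weight n" for n
      unfolding lookup_f H_weight_def
      by (rule fvs.span_sum) (auto intro: fvs.span_scale fvs.span_base fvs.span_zero)
    ultimately show "\<exists>f. (\<forall>n. Poly_Mapping.lookup f n \<in> H_weight n) \<and>
        u = (\<Sum>n\<in>Poly_Mapping.keys f. Poly_Mapping.lookup f n)"
      by blast
  next
    fix f g :: "nat \<Rightarrow>\<^sub>0 H"
    \<comment> \<open>For uniqueness: every coefficient of every component is forced, being that of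
      \<open>u\<close> when the weight fits and zero otherwise.\<close>
    have lookup: "Poly_Mapping.lookup (Poly_Mapping.lookup h n) s =
        (if weight s = n then Poly_Mapping.lookup u s else 0)"
      if h: "(\<forall>n. Poly_Mapping.lookup h n \<in> H_weight n) \<and> u = (\<Sum>n\<in>Poly_Mapping.keys h. Poly_Mapping.lookup h n)"
      for h n s
    proof -
      have zero: "Poly_Mapping.lookup (Poly_Mapping.lookup h m) s = 0" if "weight s \<noteq> m" for m
        using h that unfolding mem_H_weight by (metis in_keys_iff)
      have "Poly_Mapping.lookup u s = (\<Sum>n\<in>Poly_Mapping.keys h. Poly_Mapping.lookup (Poly_Mapping.lookup h n) s)"
        using h by (metis lookup_sum)
      also have "\<dots> = (\<Sum>n\<in>Poly_Mapping.keys h. if n = weight s then Poly_Mapping.lookup (Poly_Mapping.lookup h n) s else 0)"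
        by (rule sum.cong) (auto simp: zero)
      also have "\<dots> = Poly_Mapping.lookup (Poly_Mapping.lookup h (weight s)) s"
        by (auto simp: in_keys_iff)
      finally show ?thesis using zero by auto
    qed
    assume "(\<forall>n. Poly_Mapping.lookup f n \<in> H_weight n) \<and> u = (\<Sum>n\<in>Poly_Mapping.keys f. Poly_Mapping.lookup f n)"
      "(\<forall>n. Poly_Mapping.lookup g n \<in> H_weight n) \<and> u = (\<Sum>n\<in>Poly_Mapping.keys g. Poly_Mapping.lookup g n)"
    then show "f = g"
      by (intro poly_mapping_eqI) (simp add: lookup)
  qed
qed

section \<open>Homogeneity of the product and the coproduct\<close>

lemma shuffle_words_length:
  "shuffle_words u v \<in> fvs.span {bas w | w. length w = length u + length v}"
proof (induction u v rule: shuffle_words.induct)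
  case (3 a u b v)
  have pre: "prepend c x \<in> fvs.span {bas w | w. length w = Suc n}"
    if "x \<in> fvs.span {bas w | w. length w = n}" for c n and x :: "'a list \<Rightarrow>\<^sub>0 rat"
    using that by (rule lin_mem_span[OF lin_prepend[OF lin_ident] _ fvs.subspace_span])
      (auto intro!: fvs.span_base simp: prepend_bas)
  have "prepend a (shuffle_words u (b # v)) \<in> fvs.span {bas w | w. length w = Suc (length u + length (b # v))}"
    "prepend b (shuffle_words (a # u) v) \<in> fvs.span {bas w | w. length w = Suc (length (a # u) + length v)}"
    using 3 by (auto intro!: pre)
  then show ?case by (auto intro: fvs.span_add)
qed (auto intro!: fvs.span_base)

text \<open>Translates weight into word length, which is additive under shuffling.\<close>

lemma length_rho_word: "length (rho_word s) = weight s"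
proof (induction s)
  case (Cons x s)
  then show ?case using nat_of_num_pos[of x] by (simp add: weight_def)
qed (simp add: weight_def)

lemma H_shuffle_weight:
  assumes "u \<in> H_weight p" "v \<in> H_weight q"
  shows "H_shuffle u v \<in> H_weight (p + q)"
proof -
  have bas: "H_shuffle (bas s) (bas t) \<in> H_weight (weight s + weight t)" for s t
    unfolding mem_H_weight
  proof
    fix r assume "r \<in> Poly_Mapping.keys (H_shuffle (bas s) (bas t))"
    then have "rho_word r \<in> Poly_Mapping.keys (shuffle_words (rho_word s) (rho_word t))"
      by (simp add: in_keys_iff rho_H_shuffle rho_bas shuffle_bas flip: lookup_rho)
    then show "weight r = weight s + weight t"
      using shuffle_words_length[of "rho_word s" "rho_word t"]
      by (auto simp: mem_span_bas length_rho_word)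
  qed
  have sub: "fvs.subspace (H_weight (p + q))"
    unfolding H_weight_def by (rule fvs.subspace_span)
  have "H_shuffle (bas s) v \<in> H_weight (p + q)" if "weight s = p" for s
    by (rule lin_mem_span[OF lin_H_shuffle_right assms(2)[unfolded H_weight_def] sub])
      (use bas[of s] that in auto)
  then show ?thesis
    by (intro lin_mem_span[OF lin_H_shuffle_left assms(1)[unfolded H_weight_def] sub]) auto
qed

lemma D_op_weight: "D_op i (bas s) \<in> H_weight (Suc (weight s))"
proof -
  have incr: "bas (incr j s) \<in> H_weight (Suc (weight s))" if "1 \<le> j" "j \<le> dep s" for j
  proof -
    have j: "j - 1 < length s" using that by simp
    have "s ! (j - 1) \<in> set s" using j by simp
    \<comment> \<open>\<open>sum_list_update\<close> subtracts the old entry in \<open>nat\<close>;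
      this bound makes the subtraction exact.\<close>
    then have "nat_of_num (s ! (j - 1)) \<le> sum_list (map nat_of_num s)"
      by (intro member_le_sum_list) auto
    then have "weight (incr j s) = Suc (weight s)"
      using j by (simp add: weight_def incr_def map_update sum_list_update nat_of_num_add)
    then show ?thesis by (auto simp: H_weight_def intro!: fvs.span_base)
  qed
  have delta: "delta i (bas s) \<in> H_weight (Suc (weight s))" for i
    unfolding delta_def lin_ext_bas H_weight_def
    using incr by (auto simp: H_weight_def intro!: fvs.span_sum fvs.span_scale fvs.span_zero)
  show ?thesis
    unfolding D_op_def H_weight_def by (intro fvs.span_diff delta[unfolded H_weight_def])
qed

lemma tensor_weight:
  assumes "u \<in> H_weight p" "v \<in> H_weight q"
  shows "u \<otimes>\<^sub>\<rat> v \<in> fvs.span {bas x | x. weight (fst x) + weight (snd x) = p + q}" (is "_ \<in> ?V")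
proof -
  have "bas s \<otimes>\<^sub>\<rat> v \<in> ?V" if "weight s = p" for s
    by (rule lin_mem_span[OF lin_tensor_right[OF lin_ident] assms(2)[unfolded H_weight_def] fvs.subspace_span])
      (use that in \<open>force intro: fvs.span_base simp: tensor_bas\<close>)
  then show ?thesis
    by (intro lin_mem_span[OF lin_tensor_left[OF lin_ident] assms(1)[unfolded H_weight_def] fvs.subspace_span]) auto
qed

lemma bas_H_weight: "bas s \<in> H_weight (weight s)"
  by (auto simp: H_weight_def intro!: fvs.span_base)

lemma rec_step_weight:
  assumes "x \<in> fvs.span {bas x | x. weight (fst x) + weight (snd x) = n}"
  shows "shifted_tensor id i x + tensor_map (D_op i) id x \<in>
    fvs.span {bas x | x. weight (fst x) + weight (snd x) = Suc n}"
proof (rule lin_mem_span[OF lin_rec_step assms fvs.subspace_span])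
  fix y :: HH assume "y \<in> {bas x | x. weight (fst x) + weight (snd x) = n}"
  then obtain s t where y: "y = bas (s, t)" "weight s + weight t = n" by auto
  have "bas s \<otimes>\<^sub>\<rat> D_op (i - int (dep s)) (bas t) \<in> fvs.span {bas x | x. weight (fst x) + weight (snd x) = Suc n}"
    using tensor_weight[OF bas_H_weight D_op_weight, of s "i - int (dep s)" t] y(2) by simp
  moreover have "D_op i (bas s) \<otimes>\<^sub>\<rat> bas t \<in> fvs.span {bas x | x. weight (fst x) + weight (snd x) = Suc n}"
    using tensor_weight[OF D_op_weight bas_H_weight, of i s t] y(2) by simp
  ultimately show "shifted_tensor id i y + tensor_map (D_op i) id y \<in>
      fvs.span {bas x | x. weight (fst x) + weight (snd x) = Suc n}"
    unfolding y(1) by (simp add: shifted_tensor_def tensor_map_def fvs.span_add)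
qed

lemma weight_mon: "weight (map pnum l) = length l + sum_list l"
  by (induction l) (simp_all add: weight_def)

text \<open>Follows the recursion and not the basis \<open>ubas\<close>: each raise adds one to the
  weight of the tuple and, by \<open>rec_step_weight\<close>, to that of its coproduct.\<close>

lemma H_cop_mon_weight: "H_cop (mon l) \<in> fvs.span {bas x | x. weight (fst x) + weight (snd x) = weight (map pnum l)}"
proof (induction l rule: list_raise_induct)
  case (zero k)
  have "H_cop (mon (replicate k 0)) = (\<Sum>j\<le>k. bas (map pnum (replicate j 0), map pnum (replicate (k - j) 0)))"
    using is_rec_coproduct_H_cop unfolding is_rec_coproduct_iff by (simp add: mon_def tensor_bas)
  moreover have "bas (map pnum (replicate j 0), map pnum (replicate (k - j) 0)) \<in>
      {bas x | x. weight (fst x) + weight (snd x) = weight (map pnum (replicate k 0))}" if "j \<le> k" for j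
    using that
    by (intro CollectI exI[of _ "(map pnum (replicate j 0), map pnum (replicate (k - j) 0))"])
      (simp add: weight_mon sum_list_replicate del: map_replicate)
  ultimately show ?case
    by (simp only:) (intro fvs.span_sum fvs.span_base, simp)
next
  case (raise l j)
  have "weight (map pnum (l[j := Suc (l ! j)])) = Suc (weight (map pnum l))"
    using raise(1) elem_le_sum_list[of j l] unfolding weight_mon by (simp add: sum_list_update)
  then show ?case
    unfolding is_rec_coproduct_mon_Suc[OF is_rec_coproduct_H_cop raise(1)]
    using rec_step_weight[OF raise(2)] by (auto intro: fvs.span_scale)
qed

lemma H_cop_weight:
  assumes "u \<in> H_weight n"
  shows "H_cop u \<in> fvs.span {v \<otimes>\<^sub>\<rat> w | v w p q. v \<in> H_weight p \<and> w \<in> H_weight q \<and> p + q = n}"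
proof -
  have "H_cop u \<in> fvs.span {bas x | x. weight (fst x) + weight (snd x) = n}"
  proof (rule lin_mem_span[OF lin_H_cop assms[unfolded H_weight_def] fvs.subspace_span])
    fix a :: H assume "a \<in> {bas s | s. weight s = n}"
    then obtain s where s: "a = bas s" "weight s = n" by auto
    have "map pnum (map (\<lambda>x. nat_of_num x - 1) s) = s" by (simp add: comp_def del: One_nat_def)
    then show "H_cop a \<in> fvs.span {bas x | x. weight (fst x) + weight (snd x) = n}"
      using H_cop_mon_weight[of "map (\<lambda>x. nat_of_num x - 1) s"] s by (simp only: bas_eq_mon[of s])
  qed
  moreover have "{bas x | x. weight (fst x) + weight (snd x) = n} \<subseteq>
      {v \<otimes>\<^sub>\<rat> w | v w p q. v \<in> H_weight p \<and> w \<in> H_weight q \<and> p + q = n}"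
    using bas_H_weight by (auto simp: tensor_bas[symmetric]) blast
  ultimately show ?thesis using fvs.span_mono by blast
qed

theorem theorem2p5:
  shows "(\<exists>!\<Delta>. is_rec_coproduct \<Delta>) \<and>
    (\<forall>\<Delta>. is_rec_coproduct \<Delta> \<longrightarrow>
      connected_bialgebra H_weight H_shuffle \<Delta> H_one H_counit \<and>
      hopf_algebra H_shuffle \<Delta> H_one H_counit)"
proof -
  have "H_weight 0 = fvs.span {H_one}"
    by (simp add: H_weight_def weight_eq_0 H_one_def)
  moreover have "H_one \<in> H_weight 0"
    using bas_H_weight[of "[]"] by (simp add: H_one_def weight_def)
  moreover have "H_counit u = 0" if "u \<in> H_weight n" "n > 0" for n u
    using that unfolding mem_H_weight H_counit_def by (metis in_keys_iff weight_eq_0 less_numeral_extra(3))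
  ultimately have "connected_bialgebra H_weight H_shuffle H_cop H_one H_counit"
    unfolding connected_bialgebra_def graded_bialgebra_def
    using H.is_bialgebra grading_H_weight H_shuffle_weight H_cop_weight by blast
  \<comment> \<open>By uniqueness any map meeting the specification is \<open>H_cop\<close>, so what
    was shown for \<open>H_cop\<close> holds for it.\<close>
  then show ?thesis
    using is_rec_coproduct_H_cop is_rec_coproduct_unique H.is_hopf_algebra by metis
qed

end
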